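(* Let $l_1,l_2\ge1$ be integers. The series $f_{(1,1)}$ appearing in the ordered product factorization of $T_{(1,0),\prod_k(1+s_kx)}\,T_{(0,1),\prod_l(1+t_ly)}$ in the tropical vertex group is given as $$f_{(1,1)}=\prod_{k=1}^{l_1}\prod_{l=1}^{l_2}R^{k,l},$$ where the series $R^{k,l}\in B$ ($1\le k\le l_1$, $1\le l\le l_2$) are determined by the system of functional equations $$R^{k,l}=1+s_kt_l\,xy\prod_{k'\ne k}\prod_{l'\ne l}R^{k',l'}.$$
   Context: Let $R=\mathbb{Q}[[s_1,\dots,s_{l_1},t_1,\dots,t_{l_2}]]$ with maximal ideal $\mathfrak m$, and $B=\mathbb{Q}[x^{\pm1},y^{\pm1}]\widehat\otimes R=\mathbb{Q}[x^{\pm1},y^{\pm1}][[s_1,\dots,s_{l_1},t_1,\dots,t_{l_2}]]$. For $(a,b)\in\mathbb{Z}^2$ and $f\in 1+x^ay^b\mathbb{Q}[x^ay^b]\widehat\otimes\mathfrak m$ let $T_{(a,b),f}$ be the $R$-linear automorphism of $B$ with $x\mapsto xf^{-b}$, $y\mapsto yf^{a}$. The tropical vertex group $H\subset{\rm Aut}_R(B)$ is the $\mathfrak m$-adic completion of the subgroup generated by all $T_{(a,b),f}$. By Kontsevich–Soibelman there is a unique factorization in $H$ $$T_{(1,0),\prod_{k=1}^{l_1}(1+s_kx)}\,T_{(0,1),\prod_{l=1}^{l_2}(1+t_ly)}=\prod_{b/a\text{ decreasing}}T_{(a,b),f_{(a,b)}},$$ the ordered product (composition of maps, $(TS)(z)=T(S(z))$)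 ranging over all coprime $(a,b)\in\mathbb{N}^2$ ($0\in\mathbb{N}$), from $(0,1)$ on the left to $(1,0)$ on the right. This defines the series $f_{(a,b)}$. *)

theory Defs
  imports Complex_Main "HOL-Library.Poly_Mapping" "HOL-Library.Product_Plus"
begin

section \<open>Formal power series in the variables \<open>'v\<close>\<close>

text \<open>A power series is an arbitrary family of coefficients indexed by the monomials
  \<open>'v \<Rightarrow>\<^sub>0 nat\<close>. For finite \<open>'v\<close> this is the usual ring \<open>'a[[v\<^sub>1, \<dots>, v\<^sub>n]]\<close> with
  \<open>n = CARD('v)\<close>.\<close>

typedef ('v, 'a) mps = "UNIV :: (('v \<Rightarrow>\<^sub>0 nat) \<Rightarrow> 'a) set"
  morphisms mps_coeff Abs_mps
  by simp

lemma mps_eqI: "(\<And>n. mps_coeff f n = mps_coeff g n) \<Longrightarrow> f = g"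
  by (metis mps_coeff_inverse ext)

lemma mps_coeff_Abs [simp]: "mps_coeff (Abs_mps h) n = h n"
  by (simp add: Abs_mps_inverse)

definition antidiagonal :: "('v \<Rightarrow>\<^sub>0 nat) \<Rightarrow> (('v \<Rightarrow>\<^sub>0 nat) \<times> ('v \<Rightarrow>\<^sub>0 nat)) set" where
  "antidiagonal n = {(i, j). i + j = n}"

lemma finite_antidiagonal [simp]: "finite (antidiagonal n)"
proof -
  let ?lk = "Poly_Mapping.lookup :: ('a \<Rightarrow>\<^sub>0 nat) \<Rightarrow> 'a \<Rightarrow> nat"
  let ?K = "Poly_Mapping.keys n"
  let ?M = "\<Union>v\<in>?K. {..?lk n v}"
  let ?F = "{h. \<forall>v. (v \<in> ?K \<longrightarrow> h v \<in> ?M) \<and> (v \<notin> ?K \<longrightarrow> h v = 0)}"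
  have fin: "finite ?F"
    by (rule finite_set_of_finite_funs) auto
  have sub: "?lk i \<in> ?F \<and> ?lk j \<in> ?F" if "(i, j) \<in> antidiagonal n" for i j
  proof -
    have eq: "?lk n v = ?lk i v + ?lk j v" for v
      using that by (auto simp: antidiagonal_def lookup_add)
    have "?lk i v \<in> ?M \<and> ?lk j v \<in> ?M" if "v \<in> ?K" for v
      using that eq[of v] by (metis UN_I atMost_iff le_add1 le_add2)
    moreover have "?lk i v = 0 \<and> ?lk j v = 0" if "v \<notin> ?K" for v
      using that eq[of v] by (simp add: in_keys_iff)
    ultimately show ?thesis
      by blast
  qed
  have "inj ?lk"
    by (rule injI) (simp add: poly_mapping_eqI)
  then have "inj_on (map_prod ?lk ?lk) (antidiagonal n)"
    by (meson inj_on_subset prod.inj_map subset_UNIV)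
  moreover have "map_prod ?lk ?lk ` antidiagonal n \<subseteq> ?F \<times> ?F"
    using sub by auto
  ultimately show ?thesis
    using fin by (meson finite_SigmaI finite_subset finite_imageD)
qed

lemma antidiagonal_zero [simp]: "antidiagonal 0 = {(0, 0)}"
proof -
  have "i = 0 \<and> j = 0" if "i + j = 0" for i j :: "'v \<Rightarrow>\<^sub>0 nat"
  proof -
    have "Poly_Mapping.lookup i v + Poly_Mapping.lookup j v = 0" for v
      using that by (metis lookup_add lookup_zero)
    then show ?thesis
      by (auto intro!: poly_mapping_eqI)
  qed
  then show ?thesis
    by (auto simp: antidiagonal_def)
qed

instantiation mps :: (type, comm_ring_1) comm_ring_1
begin

definition zero_mps where "0 = Abs_mps (\<lambda>n. 0)"
definition one_mps where "1 = Abs_mps (\<lambda>n. if n = 0 then 1 else 0)"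
definition plus_mps where "f + g = Abs_mps (\<lambda>n. mps_coeff f n + mps_coeff g n)"
definition uminus_mps where "- f = Abs_mps (\<lambda>n. - mps_coeff f n)"
definition minus_mps where "f - g = Abs_mps (\<lambda>n. mps_coeff f n - mps_coeff g n)"
definition times_mps where
  "f * g = Abs_mps (\<lambda>n. \<Sum>(i, j)\<in>antidiagonal n. mps_coeff f i * mps_coeff g j)"

lemmas mps_ops = zero_mps_def one_mps_def plus_mps_def uminus_mps_def minus_mps_def times_mps_def

instance
proof
  fix f g h :: "('a, 'b) mps"
  show "f * g * h = f * (g * h)"
  proof (rule mps_eqI)
    fix n
    let ?a = "mps_coeff f" and ?b = "mps_coeff g" and ?c = "mps_coeff h"
    have "mps_coeff (f * g * h) n
        = (\<Sum>p\<in>antidiagonal n. \<Sum>q\<in>antidiagonal (fst p). ?a (fst q) * ?b (snd q) * ?c (snd p))"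
      by (simp add: mps_ops case_prod_unfold sum_distrib_right)
    also have "\<dots> = (\<Sum>(p, q)\<in>Sigma (antidiagonal n) (\<lambda>p. antidiagonal (fst p)).
        ?a (fst q) * ?b (snd q) * ?c (snd p))"
      by (rule sum.Sigma) auto
    also have "\<dots> = (\<Sum>(p, q)\<in>Sigma (antidiagonal n) (\<lambda>p. antidiagonal (snd p)).
        ?a (fst p) * (?b (fst q) * ?c (snd q)))"
      by (rule sum.reindex_bij_witness
          [where i = "\<lambda>((i, m), (j, k)). ((i + j, k), (i, j))"
             and j = "\<lambda>((m, k), (i, j)). ((i, j + k), (j, k))"])
        (auto simp: antidiagonal_def add.assoc mult.assoc)
    also have "\<dots> = (\<Sum>p\<in>antidiagonal n. \<Sum>q\<in>antidiagonal (snd p).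
        ?a (fst p) * (?b (fst q) * ?c (snd q)))"
      by (rule sum.Sigma [symmetric]) auto
    also have "\<dots> = mps_coeff (f * (g * h)) n"
      by (simp add: mps_ops case_prod_unfold sum_distrib_left)
    finally show "mps_coeff (f * g * h) n = mps_coeff (f * (g * h)) n" .
  qed
  show "f * g = g * f"
  proof (rule mps_eqI)
    fix n
    have "(\<Sum>(i, j)\<in>antidiagonal n. mps_coeff f i * mps_coeff g j)
        = (\<Sum>(i, j)\<in>antidiagonal n. mps_coeff g i * mps_coeff f j)"
      by (rule sum.reindex_bij_witness [where i = prod.swap and j = prod.swap])
        (auto simp: antidiagonal_def add.commute mult.commute)
    then show "mps_coeff (f * g) n = mps_coeff (g * f) n"
      by (simp add: mps_ops)
  qed
  show "1 * f = f"
  proof (rule mps_eqI)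
    fix n
    have "mps_coeff (1 * f) n
        = (\<Sum>p\<in>antidiagonal n. if p = (0, n) then mps_coeff f n else 0)"
      by (auto simp: mps_ops antidiagonal_def intro!: sum.cong)
    moreover have "(0, n) \<in> antidiagonal n"
      by (simp add: antidiagonal_def)
    then have "(\<Sum>p\<in>antidiagonal n. if p = (0, n) then mps_coeff f n else 0) = mps_coeff f n"
      by simp
    ultimately show "mps_coeff (1 * f) n = mps_coeff f n"
      by simp
  qed
  show "(f + g) * h = f * h + g * h"
    by (rule mps_eqI)
      (simp add: mps_ops case_prod_unfold distrib_right sum.distrib)
  show "(0 :: ('a, 'b) mps) \<noteq> 1"
  proof
    assume "(0 :: ('a, 'b) mps) = 1"
    then have "mps_coeff (0 :: ('a, 'b) mps) 0 = mps_coeff 1 0"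
      by simp
    then show False
      by (simp add: mps_ops)
  qed
qed (rule mps_eqI, simp add: mps_ops algebra_simps)+

end

text \<open>The inverse of a unit (and \<open>0\<close> for non-units) makes the integer powers \<open>f powi n\<close>
  of a unit \<open>f\<close> available.\<close>

instantiation mps :: (type, comm_ring_1) inverse
begin

definition inverse_mps where
  "inverse (f :: ('a, 'b) mps) = (if f dvd 1 then THE g. f * g = 1 else 0)"

definition divide_mps where
  "divide (f :: ('a, 'b) mps) g = f * inverse g"

instance ..

end

definition mps_const :: "'a \<Rightarrow> ('v, 'a :: zero) mps" where
  "mps_const c = Abs_mps (\<lambda>n. if n = 0 then c else 0)"

definition mps_var :: "'v \<Rightarrow> ('v, 'a :: zero_neq_one) mps" where
  "mps_var v = Abs_mps (\<lambda>n. if n = Poly_Mapping.single v 1 then 1 else 0)"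


section \<open>The rings \<open>R\<close> and \<open>B\<close>\<close>

text \<open>The integers \<open>l\<^sub>1, l\<^sub>2 \<ge> 1\<close> are the cardinalities of the finite index types \<open>'k\<close> and
  \<open>'l\<close>; the variable \<open>s\<^sub>k\<close> is \<open>Inl k\<close> and \<open>t\<^sub>l\<close> is \<open>Inr l\<close>. Laurent polynomials in \<open>x, y\<close>
  are finitely supported functions on the exponents \<open>(m, n)\<close> of \<open>x\<^sup>m y\<^sup>n\<close>, so an element of
  \<open>B\<close> has one Laurent polynomial as coefficient of each monomial in the \<open>s\<^sub>k, t\<^sub>l\<close>.\<close>

type_synonym laurent = "int \<times> int \<Rightarrow>\<^sub>0 rat"

type_synonym ('k, 'l) R_ring = "('k + 'l, rat) mps"

type_synonym ('k, 'l) B_ring = "('k + 'l, laurent) mps"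

definition of_R :: "('k, 'l) R_ring \<Rightarrow> ('k, 'l) B_ring" where
  "of_R r = Abs_mps (\<lambda>n. Poly_Mapping.single 0 (mps_coeff r n))"

definition max_ideal :: "('k, 'l) R_ring set" where
  "max_ideal = {r. mps_coeff r 0 = 0}"

text \<open>The ideal \<open>m\<^sup>N B\<close>; \<open>module.span times S\<close> is the ideal of \<open>B\<close> generated by \<open>S\<close>.\<close>

definition madic_ideal :: "nat \<Rightarrow> ('k, 'l) B_ring set" where
  "madic_ideal N =
     module.span times {of_R (prod_list rs) | rs. length rs = N \<and> set rs \<subseteq> max_ideal}"

definition s_var :: "'k \<Rightarrow> ('k, 'l) B_ring" where
  "s_var k = mps_var (Inl k)"

definition t_var :: "'l \<Rightarrow> ('k, 'l) B_ring" where
  "t_var l = mps_var (Inr l)"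

definition x_var :: "('k, 'l) B_ring" where
  "x_var = mps_const (Poly_Mapping.single (1, 0) 1)"

definition y_var :: "('k, 'l) B_ring" where
  "y_var = mps_const (Poly_Mapping.single (0, 1) 1)"


section \<open>The tropical vertex group\<close>

definition R_automorphisms :: "(('k, 'l) B_ring \<Rightarrow> ('k, 'l) B_ring) set" where
  "R_automorphisms = {\<phi>. bij \<phi> \<and> \<phi> 1 = 1 \<and>
     (\<forall>F G. \<phi> (F + G) = \<phi> F + \<phi> G) \<and> (\<forall>F G. \<phi> (F * G) = \<phi> F * \<phi> G) \<and>
     (\<forall>r F. \<phi> (of_R r * F) = of_R r * \<phi> F)}"

text \<open>The set \<open>1 + x\<^sup>a y\<^sup>b \<rat>[x\<^sup>a y\<^sup>b] \<otimes> m\<close> (completed tensor product): apart from the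
  constant term \<open>1\<close>, every monomial in the \<open>s\<^sub>k, t\<^sub>l\<close> is nontrivial and has as coefficient a
  polynomial in \<open>x\<^sup>a y\<^sup>b\<close> without constant term.\<close>

definition tv_series :: "int \<Rightarrow> int \<Rightarrow> ('k, 'l) B_ring set" where
  "tv_series a b = {f. mps_coeff f 0 = 1 \<and>
     (\<forall>n. n \<noteq> 0 \<longrightarrow>
        Poly_Mapping.keys (mps_coeff f n) \<subseteq> {(int i * a, int i * b) | i. i \<ge> 1})}"

text \<open>An \<open>R\<close>-automorphism maps \<open>m\<^sup>N B\<close> to itself, so it is continuous and determined by the
  images of \<open>x\<close> and \<open>y\<close>. Elements of \<open>tv_series a b\<close> are units of \<open>B\<close>, and for these the
  automorphism exists (its inverse belongs to \<open>f powi (- 1)\<close>).\<close>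

definition tv_aut :: "int \<Rightarrow> int \<Rightarrow> ('k, 'l) B_ring \<Rightarrow> ('k, 'l) B_ring \<Rightarrow> ('k, 'l) B_ring" where
  "tv_aut a b f = (THE \<phi>. \<phi> \<in> R_automorphisms \<and>
     \<phi> x_var = x_var * f powi (- b) \<and> \<phi> y_var = y_var * f powi a)"

inductive_set tv_generated :: "(('k, 'l) B_ring \<Rightarrow> ('k, 'l) B_ring) set" where
  tv_id: "id \<in> tv_generated"
| tv_mult: "f \<in> tv_series a b \<Longrightarrow> \<psi> \<in> tv_generated \<Longrightarrow> tv_aut a b f \<circ> \<psi> \<in> tv_generated"
| tv_inv: "f \<in> tv_series a b \<Longrightarrow> \<psi> \<in> tv_generated \<Longrightarrow> inv (tv_aut a b f) \<circ> \<psi> \<in> tv_generated"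

definition madic_cong :: "nat \<Rightarrow> (('k, 'l) B_ring \<Rightarrow> ('k, 'l) B_ring)
    \<Rightarrow> (('k, 'l) B_ring \<Rightarrow> ('k, 'l) B_ring) \<Rightarrow> bool" where
  "madic_cong N \<phi> \<psi> \<longleftrightarrow> (\<forall>F. \<phi> F - \<psi> F \<in> madic_ideal N)"

text \<open>Since \<open>B\<close> is complete, the completion of the generated subgroup is its closure in the
  automorphism group.\<close>

definition tropical_vertex_group :: "(('k, 'l) B_ring \<Rightarrow> ('k, 'l) B_ring) set" where
  "tropical_vertex_group =
     {\<phi> \<in> R_automorphisms. \<forall>N. \<exists>\<psi>\<in>tv_generated. madic_cong N \<phi> \<psi>}"


section \<open>Ordered product factorizations\<close>

definition slope_greater :: "nat \<times> nat \<Rightarrow> nat \<times> nat \<Rightarrow> bool" where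
  "slope_greater = (\<lambda>(a, b) (a', b'). b * a' > b' * a)"

definition finite_ordered_product :: "(nat \<times> nat \<Rightarrow> ('k, 'l) B_ring) \<Rightarrow> (nat \<times> nat) list
    \<Rightarrow> ('k, 'l) B_ring \<Rightarrow> ('k, 'l) B_ring" where
  "finite_ordered_product f ps =
     foldr (\<circ>) (map (\<lambda>p. tv_aut (int (fst p)) (int (snd p)) (f p)) ps) id"

text \<open>The infinite ordered product is the limit, in the \<open>m\<close>-adic topology, of the net of
  ordered products over finite sets of coprime pairs. Such a set is represented by its list in
  order of decreasing slope \<open>b/a\<close>, so that the factor of \<open>(0, 1)\<close> is leftmost and that of
  \<open>(1, 0)\<close> rightmost. The values of \<open>f\<close> at non-coprime pairs are irrelevant.\<close>

definition ordered_factorization ::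
  "(('k, 'l) B_ring \<Rightarrow> ('k, 'l) B_ring) \<Rightarrow> (nat \<times> nat \<Rightarrow> ('k, 'l) B_ring) \<Rightarrow> bool" where
  "ordered_factorization \<theta> f \<longleftrightarrow>
     \<theta> \<in> tropical_vertex_group \<and>
     (\<forall>a b. coprime a b \<longrightarrow> f (a, b) \<in> tv_series (int a) (int b)) \<and>
     (\<forall>N. \<exists>S. finite S \<and> S \<subseteq> {(a, b). coprime a b} \<and>
        (\<forall>ps. S \<subseteq> set ps \<and> set ps \<subseteq> {(a, b). coprime a b} \<and> sorted_wrt slope_greater ps \<longrightarrow>
           madic_cong N (finite_ordered_product f ps) \<theta>))"

end

theory Submission
  imports Defs
begin

text \<open>
Grade \<open>B\<close> by giving \<open>x\<close> degree \<open>1\<close> and \<open>y\<close> degree \<open>-1\<close>, and let \<open>z = x y\<close>. In an ordered factorization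
\<open>\<theta> = L \<circ> D \<circ> U\<close>, with \<open>L\<close> collecting the slopes above one, \<open>D\<close> the factor of slope one and \<open>U\<close> the slopes
below one, the map \<open>L\<close> is the identity up to terms of lower degree, \<open>U\<close> is the identity up to terms of
higher degree, and \<open>D\<close> preserves degrees. It is thus a Birkhoff factorization, and \<open>f = f\<^bsub>(1,1)\<^esub>\<close> is found
by solving a Birkhoff problem for the images of the two generators.

Put \<open>A = L\<^sup>-\<^sup>1 x\<close>, \<open>Y = L\<^sup>-\<^sup>1 y\<close>, \<open>X = D (U x)\<close>, \<open>B = D (U y)\<close>. Since \<open>\<theta> y = y \<Prod>\<^sub>k(1 + s\<^sub>k x)\<close> and
\<open>\<theta> x \<Prod>\<^sub>l(1 + t\<^sub>l \<theta> y) = x\<close>, applying \<open>L\<^sup>-\<^sup>1\<close> gives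
\<open>A = X \<Prod>\<^sub>l(1 + t\<^sub>l B)\<close> and \<open>B = Y \<Prod>\<^sub>k(1 + s\<^sub>k A)\<close>,
where \<open>A - x\<close> has degrees at most \<open>0\<close>, \<open>X\<close> at least \<open>1\<close>, \<open>B - y f\<close> at least \<open>0\<close>, and \<open>Y - y\<close> at most
\<open>-2\<close> (\<open>ordered_factorization_imp_birkhoff_mod\<close>). These conditions determine \<open>A\<close>, \<open>B\<close> and \<open>f\<close>: modulo one
more power of the maximal ideal the products do not contribute to differences of two solutions, and the
degree bounds leave nothing for the differences themselves (\<open>birkhoff_mod_unique\<close>).

It remains to exhibit a solution with \<open>f = \<Prod> R k l\<close> (\<open>functional_equations_birkhoff_mod\<close>). It has the
form \<open>A = x \<Prod>\<^sub>l(1 + \<beta>\<^sub>l y)\<close>, \<open>B = y f \<Prod>\<^sub>k(1 + \<alpha>\<^sub>k x)\<close>, as Weierstrass preparation of the factors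
\<open>1 + t\<^sub>l B\<close> and \<open>1 + s\<^sub>k A\<close> suggests. The conditions on \<open>\<alpha>\<^sub>k\<close> and \<open>\<beta>\<^sub>l\<close> become the functional equations under
\<open>1 / R k l = 1 - \<alpha>\<^sub>k \<beta>\<^sub>l z\<close>.

The factorization is a limit, so the argument is carried out modulo each power of the maximal ideal. Before
it can start, the automorphisms \<open>T\<^bsub>(a,b),f\<^esub>\<close> have to be constructed as substitutions, and
\<open>R\<close>-endomorphisms have to be shown to be determined by the images of \<open>x\<close> and \<open>y\<close>.
\<close>

section \<open>Coefficients and the filtration by total degree\<close>

lemma mps_coeff_zero [simp]: "mps_coeff 0 n = 0"
  and mps_coeff_one: "mps_coeff 1 n = (if n = 0 then 1 else 0)"
  and mps_coeff_add [simp]: "mps_coeff (F + G) n = mps_coeff F n + mps_coeff G n"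
  and mps_coeff_minus [simp]: "mps_coeff (- F) n = - mps_coeff F n"
  and mps_coeff_diff [simp]: "mps_coeff (F - G) n = mps_coeff F n - mps_coeff G n"
  and mps_coeff_mult:
    "mps_coeff (F * G) n = (\<Sum>(i, j)\<in>antidiagonal n. mps_coeff F i * mps_coeff G j)"
  for F G :: "('v, 'a::comm_ring_1) mps"
  by (simp_all add: mps_ops)

lemma mps_coeff_sum [simp]:
  "mps_coeff (sum F A) n = (\<Sum>i\<in>A. mps_coeff (F i) n)"
  for F :: "'i \<Rightarrow> ('v, 'a::comm_ring_1) mps"
  by (induction A rule: infinite_finite_induct) auto

lemma antidiagonal_zero_left [simp]: "(0, n) \<in> antidiagonal n"
  and antidiagonal_zero_right [simp]: "(n, 0) \<in> antidiagonal n"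
  by (simp_all add: antidiagonal_def)

lemma mps_coeff_const: "mps_coeff (mps_const c) n = (if n = 0 then c else 0)"
  by (simp add: mps_const_def)

lemma sum_antidiagonal_left_zero:
  assumes "\<And>i j. (i, j) \<in> antidiagonal n \<Longrightarrow> i \<noteq> 0 \<Longrightarrow> h i j = (0::'a::comm_monoid_add)"
  shows "(\<Sum>(i, j)\<in>antidiagonal n. h i j) = h 0 n"
proof -
  have "(\<Sum>(i, j)\<in>antidiagonal n. h i j) = (\<Sum>(i, j)\<in>{(0, n)}. h i j)"
  proof (rule sum.mono_neutral_right)
    have "h i j = 0" if "(i, j) \<in> antidiagonal n" "(i, j) \<noteq> (0, n)" for i j
      using assms[OF that(1)] that by (auto simp: antidiagonal_def)
    then show "\<forall>p\<in>antidiagonal n - {(0, n)}. (case p of (i, j) \<Rightarrow> h i j) = 0"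
      by (simp add: split_paired_all)
  qed simp_all
  then show ?thesis
    by simp
qed

lemma sum_antidiagonal_right_zero:
  assumes "\<And>i j. (i, j) \<in> antidiagonal n \<Longrightarrow> j \<noteq> 0 \<Longrightarrow> h i j = (0::'a::comm_monoid_add)"
  shows "(\<Sum>(i, j)\<in>antidiagonal n. h i j) = h n 0"
proof -
  have "(\<Sum>(i, j)\<in>antidiagonal n. h i j) = (\<Sum>(i, j)\<in>{(n, 0)}. h i j)"
  proof (rule sum.mono_neutral_right)
    have "h i j = 0" if "(i, j) \<in> antidiagonal n" "(i, j) \<noteq> (n, 0)" for i j
      using assms[OF that(1)] that by (auto simp: antidiagonal_def)
    then show "\<forall>p\<in>antidiagonal n - {(n, 0)}. (case p of (i, j) \<Rightarrow> h i j) = 0"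
      by (simp add: split_paired_all)
  qed simp_all
  then show ?thesis
    by simp
qed

lemma mps_coeff_const_mult [simp]: "mps_coeff (mps_const c * F) n = c * mps_coeff F n"
  for F :: "('v, 'a::comm_ring_1) mps"
  unfolding mps_coeff_mult
  by (subst sum_antidiagonal_left_zero) (auto simp: mps_coeff_const)

lemma mps_const_add: "mps_const (c + d) = mps_const c + mps_const d"
  and mps_const_zero [simp]: "mps_const 0 = 0"
  and mps_const_one [simp]: "mps_const 1 = 1"
  and mps_const_mult: "mps_const (c * d) = mps_const c * mps_const d"
  for c d :: "'a::comm_ring_1"
  by (auto intro!: mps_eqI simp: mps_coeff_const mps_coeff_one)

lemma mps_const_sum: "mps_const (sum c A) = (\<Sum>i\<in>A. mps_const (c i))"
  for c :: "'i \<Rightarrow> 'a::comm_ring_1"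
  by (induction A rule: infinite_finite_induct) (auto simp: mps_const_add)

lemma mps_coeff_var_mult_add:
  "mps_coeff (mps_var v * F) (Poly_Mapping.single v 1 + n) = mps_coeff F n"
  for F :: "('v, 'a::comm_ring_1) mps"
proof -
  let ?s = "Poly_Mapping.single v (1::nat)"
  have "mps_coeff (mps_var v * F) (?s + n) = (\<Sum>(i, j)\<in>{(?s, n)}. mps_coeff (mps_var v) i * mps_coeff F j)"
    unfolding mps_coeff_mult
  proof (rule sum.mono_neutral_right)
    have "mps_coeff (mps_var v) i * mps_coeff F j = 0"
      if "(i, j) \<in> antidiagonal (?s + n)" "(i, j) \<noteq> (?s, n)" for i j
    proof -
      have "i \<noteq> ?s"
        using that by (auto simp: antidiagonal_def)
      then show ?thesis
        by (simp add: mps_var_def)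
    qed
    then show "\<forall>p\<in>antidiagonal (?s + n) - {(?s, n)}.
        (case p of (i, j) \<Rightarrow> mps_coeff (mps_var v) i * mps_coeff F j) = 0"
      by (simp add: split_paired_all)
  qed (simp, simp add: antidiagonal_def)
  then show ?thesis
    by (simp add: mps_var_def)
qed

lemma mps_coeff_var_mult_zero:
  fixes F :: "('v, 'a::comm_ring_1) mps"
  assumes "Poly_Mapping.lookup n v = 0"
  shows "mps_coeff (mps_var v * F) n = 0"
  unfolding mps_coeff_mult
proof (rule sum.neutral, clarify)
  fix i j
  assume "(i, j) \<in> antidiagonal n"
  then have "Poly_Mapping.lookup i v = 0"
    using assms by (auto simp: antidiagonal_def lookup_add)
  then have "i \<noteq> Poly_Mapping.single v 1"
    by auto
  then show "mps_coeff (mps_var v) i * mps_coeff F j = 0"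
    by (simp add: mps_var_def)
qed

lemma single_add_minus:
  assumes "Poly_Mapping.lookup n v \<noteq> (0::nat)"
  shows "Poly_Mapping.single v 1 + (n - Poly_Mapping.single v 1) = n"
  using assms
  by (intro poly_mapping_eqI) (auto simp: lookup_add lookup_minus lookup_single when_def)

lemma mps_coeff_var_mult:
  "mps_coeff (mps_var v * F) n =
    (if Poly_Mapping.lookup n v = 0 then 0 else mps_coeff F (n - Poly_Mapping.single v 1))"
  for F :: "('v, 'a::comm_ring_1) mps"
  using mps_coeff_var_mult_add[of v F "n - Poly_Mapping.single v 1"] single_add_minus[of n v]
  by (auto simp: mps_coeff_var_mult_zero)

definition total_degree :: "('v::finite \<Rightarrow>\<^sub>0 nat) \<Rightarrow> nat" where
  "total_degree n = (\<Sum>v\<in>UNIV. Poly_Mapping.lookup n v)"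

lemma total_degree_add: "total_degree (m + n) = total_degree m + total_degree n"
  by (simp add: total_degree_def lookup_add sum.distrib)

lemma total_degree_single [simp]: "total_degree (Poly_Mapping.single v c) = c"
  by (simp add: total_degree_def lookup_single when_def)

lemma total_degree_zero [simp]: "total_degree 0 = 0"
  by (simp add: total_degree_def)

lemma total_degree_eq_0_iff [simp]: "total_degree n = 0 \<longleftrightarrow> n = 0"
  by (auto simp: total_degree_def intro!: poly_mapping_eqI)

text \<open>The \<open>N\<close>-th power of the ideal generated by the variables. Describing it by coefficients makes
\<open>\<Inter>N. order_ideal N = {0}\<close> and all closure properties immediate.\<close>

definition order_ideal :: "nat \<Rightarrow> ('v::finite, 'a::comm_ring_1) mps set" where
  "order_ideal N = {F. \<forall>n. total_degree n < N \<longrightarrow> mps_coeff F n = 0}"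

lemma order_ideal_add: "F \<in> order_ideal N \<Longrightarrow> G \<in> order_ideal N \<Longrightarrow> F + G \<in> order_ideal N"
  and order_ideal_diff: "F \<in> order_ideal N \<Longrightarrow> G \<in> order_ideal N \<Longrightarrow> F - G \<in> order_ideal N"
  and order_ideal_minus: "F \<in> order_ideal N \<Longrightarrow> - F \<in> order_ideal N"
  and order_ideal_zero [simp]: "0 \<in> order_ideal N"
  and order_ideal_0 [simp]: "H \<in> order_ideal 0"
  by (auto simp: order_ideal_def)

lemma order_ideal_sum: "(\<And>i. i \<in> A \<Longrightarrow> F i \<in> order_ideal N) \<Longrightarrow> sum F A \<in> order_ideal N"
  by (induction A rule: infinite_finite_induct) (auto intro: order_ideal_add)

lemma order_ideal_mult:
  assumes "F \<in> order_ideal M" "G \<in> order_ideal N"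
  shows "F * G \<in> order_ideal (M + N)"
  unfolding order_ideal_def
proof (clarify, unfold mps_coeff_mult, rule sum.neutral, clarify)
  fix n i j :: "'a \<Rightarrow>\<^sub>0 nat"
  assume "total_degree n < M + N" "(i, j) \<in> antidiagonal n"
  then have "total_degree i < M \<or> total_degree j < N"
    by (auto simp: antidiagonal_def total_degree_add)
  then show "mps_coeff F i * mps_coeff G j = 0"
    using assms by (auto simp: order_ideal_def)
qed

lemma order_ideal_mult_right: "F \<in> order_ideal N \<Longrightarrow> F * G \<in> order_ideal N"
  using order_ideal_mult[of F N G 0] by simp

lemma order_ideal_mult_left: "G \<in> order_ideal N \<Longrightarrow> F * G \<in> order_ideal N"
  using order_ideal_mult[of F 0 G N] by simp

lemma order_ideal_mono: "F \<in> order_ideal N \<Longrightarrow> M \<le> N \<Longrightarrow> F \<in> order_ideal M"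
  by (auto simp: order_ideal_def)

lemma order_ideal_1_iff: "F \<in> order_ideal 1 \<longleftrightarrow> mps_coeff F 0 = 0"
  by (auto simp: order_ideal_def)

lemma order_ideal_Inter: "(\<And>N. F \<in> order_ideal N) \<Longrightarrow> F = 0"
  by (rule mps_eqI) (auto simp: order_ideal_def)

lemma order_ideal_diff_trans:
  "F - G \<in> order_ideal N \<Longrightarrow> G - H \<in> order_ideal N \<Longrightarrow> F - H \<in> order_ideal N"
  using order_ideal_add[of "F - G" N "G - H"] by simp

lemma order_ideal_diff_sym: "F - G \<in> order_ideal N \<Longrightarrow> G - F \<in> order_ideal N"
  using order_ideal_minus[of "F - G" N] by simp

lemma order_ideal_diff_mult:
  assumes "F - F' \<in> order_ideal N" "G - G' \<in> order_ideal N"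
  shows "F * G - F' * G' \<in> order_ideal N"
proof -
  have "F * G - F' * G' = (F - F') * G + F' * (G - G')"
    by (simp add: algebra_simps)
  then show ?thesis
    using assms by (simp add: order_ideal_add order_ideal_mult_left order_ideal_mult_right)
qed

lemma order_ideal_diff_prod:
  assumes "\<And>i. i \<in> A \<Longrightarrow> F i - G i \<in> order_ideal N"
  shows "prod F A - prod G A \<in> order_ideal N"
  using assms
  by (induction A rule: infinite_finite_induct) (auto intro: order_ideal_diff_mult)

lemma mps_var_in_order_ideal: "mps_var v \<in> order_ideal 1"
proof -
  have "(0 :: 'a \<Rightarrow>\<^sub>0 nat) \<noteq> Poly_Mapping.single v 1"
    by (metis total_degree_single total_degree_zero zero_neq_one)
  then show ?thesis
    unfolding order_ideal_1_iff mps_var_def by simp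
qed

text \<open>Assign every nontrivial monomial to one variable that divides it. This reduces statements about
maps that are linear over the variables to statements about constants: what holds for \<open>F'\<close>
modulo \<open>order_ideal N\<close> holds for \<open>F\<close> modulo \<open>order_ideal (Suc N)\<close>, so that induction on \<open>N\<close>
replaces infinite sums and arguments by continuity.\<close>

lemma mps_decompose:
  fixes F :: "('v::finite, 'a::comm_ring_1) mps"
  obtains F' where "F = mps_const (mps_coeff F 0) + (\<Sum>v\<in>UNIV. mps_var v * F' v)"
    and "\<And>N v. F \<in> order_ideal (Suc N) \<Longrightarrow> F' v \<in> order_ideal N"
proof -
  define w where "w n = (SOME v. Poly_Mapping.lookup n v \<noteq> (0::nat))" for n :: "'v \<Rightarrow>\<^sub>0 nat"
  have w: "Poly_Mapping.lookup n (w n) \<noteq> 0" if "n \<noteq> 0" for n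
    unfolding w_def using that by (metis (mono_tags, lifting) lookup_zero poly_mapping_eqI someI_ex)
  define F' where "F' v = Abs_mps (\<lambda>n. if w (Poly_Mapping.single v 1 + n) = v
      then mps_coeff F (Poly_Mapping.single v 1 + n) else 0)" for v
  have *: "mps_coeff (mps_var v * F' v) n =
      (if Poly_Mapping.lookup n v \<noteq> 0 \<and> w n = v then mps_coeff F n else 0)" for v n
    using single_add_minus[of n v] by (auto simp: mps_coeff_var_mult F'_def)
  have "F = mps_const (mps_coeff F 0) + (\<Sum>v\<in>UNIV. mps_var v * F' v)"
  proof (rule mps_eqI)
    fix n
    have "(\<Sum>v\<in>UNIV. mps_coeff (mps_var v * F' v) n) =
        (\<Sum>v\<in>UNIV. if v = w n then (if n = 0 then 0 else mps_coeff F n) else 0)"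
      using w[of n] by (intro sum.cong) (auto simp: *)
    then show "mps_coeff F n =
        mps_coeff (mps_const (mps_coeff F 0) + (\<Sum>v\<in>UNIV. mps_var v * F' v)) n"
      by (simp add: mps_coeff_const)
  qed
  moreover have "F' v \<in> order_ideal N" if "F \<in> order_ideal (Suc N)" for N v
    using that unfolding order_ideal_def F'_def by (auto simp: total_degree_add)
  ultimately show thesis
    using that by blast
qed

text \<open>Completeness for the filtration: the iterates of \<open>\<Phi>\<close> from \<open>0\<close> agree with each other modulo higher
and higher \<open>order_ideal N\<close>. Each coefficient of the limit is a coefficient of some iterate, hence
conditions \<open>C\<close> on single coefficients that \<open>\<Phi>\<close> preserves pass to the fixed point.\<close>

lemma contraction_fixed_point:
  fixes \<Phi> :: "('i \<Rightarrow> ('v::finite, 'a::comm_ring_1) mps) \<Rightarrow> 'i \<Rightarrow> ('v, 'a) mps"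
  assumes contr: "\<And>F G N i. (\<And>j. F j - G j \<in> order_ideal N) \<Longrightarrow> \<Phi> F i - \<Phi> G i \<in> order_ideal (Suc N)"
    and C0: "0 \<in> C"
    and C: "\<And>F i n. (\<And>j m. mps_coeff (F j) m \<in> C) \<Longrightarrow> mps_coeff (\<Phi> F i) n \<in> C"
  obtains F where "\<And>G. \<Phi> G = G \<longleftrightarrow> G = F" and "\<And>i n. mps_coeff (F i) n \<in> C"
proof -
  define S where "S k = (\<Phi> ^^ k) (\<lambda>_. 0)" for k
  have S_Suc: "S (Suc k) = \<Phi> (S k)" for k
    by (simp add: S_def)
  have step: "S (Suc k) i - S k i \<in> order_ideal k" for k i
  proof (induction k arbitrary: i)
    case (Suc k)
    then show ?case
      using contr[of "S (Suc k)" "S k" k i] by (simp add: S_Suc)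
  qed simp
  have far: "S (k + d) i - S k i \<in> order_ideal k" for k d i
  proof (induction d)
    case (Suc d)
    have "S (Suc (k + d)) i - S (k + d) i \<in> order_ideal k"
      using step[of "k + d" i] by (rule order_ideal_mono) simp
    then show ?case
      using Suc order_ideal_diff_trans by fastforce
  qed simp
  define F where "F i = Abs_mps (\<lambda>n. mps_coeff (S (Suc (total_degree n)) i) n)" for i
  have approx: "F i - S k i \<in> order_ideal k" for k i
    unfolding order_ideal_def
  proof clarify
    fix n :: "'v \<Rightarrow>\<^sub>0 nat"
    assume n: "total_degree n < k"
    then have "S k i - S (Suc (total_degree n)) i \<in> order_ideal (Suc (total_degree n))"
      using far[of "Suc (total_degree n)" "k - Suc (total_degree n)" i] by simp
    then show "mps_coeff (F i - S k i) n = 0"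
      by (simp add: order_ideal_def F_def)
  qed
  have fp: "\<Phi> F = F"
  proof
    fix i
    have "\<Phi> F i - F i \<in> order_ideal (Suc N)" for N
      using contr[of F "S N" N i, OF approx] order_ideal_diff_sym[OF approx[of i "Suc N"]]
      by (auto simp: S_Suc intro: order_ideal_diff_trans)
    then have "\<Phi> F i - F i = 0"
      by (meson order_ideal_Inter order_ideal_mono le_SucI order_refl)
    then show "\<Phi> F i = F i"
      by simp
  qed
  have uniq: "G = F" if "\<Phi> G = G" for G
  proof
    fix i
    have "G j - F j \<in> order_ideal N" for N j
    proof (induction N arbitrary: j)
      case (Suc N)
      then show ?case
        using contr[of G F N j] that fp by simp
    qed simp
    then have "G i - F i = 0"
      by (rule order_ideal_Inter)
    then show "G i = F i"
      by simp
  qed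
  have "mps_coeff (S k i) n \<in> C" for k i n
    by (induction k arbitrary: i n) (simp_all add: S_Suc C, simp add: S_def C0)
  then have "mps_coeff (F i) n \<in> C" for i n
    by (simp add: F_def)
  then show thesis
    using that[of F] fp uniq by blast
qed

section \<open>Monomial supports\<close>

definition supported :: "(int \<times> int) set \<Rightarrow> ('v, laurent) mps set" where
  "supported S = {F. \<forall>n. Poly_Mapping.keys (mps_coeff F n) \<subseteq> S}"

lemma supported_zero [simp]: "0 \<in> supported S"
  by (simp add: supported_def)

lemma supported_one [simp]: "0 \<in> S \<Longrightarrow> 1 \<in> supported S"
  by (simp add: supported_def mps_coeff_one)

lemma supported_UNIV [simp]: "F \<in> supported UNIV"
  by (simp add: supported_def)

lemma supported_mono: "F \<in> supported S \<Longrightarrow> S \<subseteq> T \<Longrightarrow> F \<in> supported T"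
  by (auto simp: supported_def)

lemma supported_add: "F \<in> supported S \<Longrightarrow> G \<in> supported S \<Longrightarrow> F + G \<in> supported S"
  using Poly_Mapping.keys_add by (fastforce simp: supported_def)

lemma supported_minus: "F \<in> supported S \<Longrightarrow> - F \<in> supported S"
  by (simp add: supported_def)

lemma supported_diff: "F \<in> supported S \<Longrightarrow> G \<in> supported S \<Longrightarrow> F - G \<in> supported S"
  using supported_add[of F S "- G"] supported_minus[of G S] by simp

lemma supported_sum: "(\<And>i. i \<in> A \<Longrightarrow> F i \<in> supported S) \<Longrightarrow> sum F A \<in> supported S"
  by (induction A rule: infinite_finite_induct) (auto intro: supported_add)

lemma keys_sum_subset:
  fixes c :: "'i \<Rightarrow> 'a \<Rightarrow>\<^sub>0 'b::comm_monoid_add"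
  assumes "\<And>i. i \<in> A \<Longrightarrow> Poly_Mapping.keys (c i) \<subseteq> S"
  shows "Poly_Mapping.keys (sum c A) \<subseteq> S"
  using assms
proof (induction A rule: infinite_finite_induct)
  case (insert i A)
  then show ?case
    using Poly_Mapping.keys_add[of "c i" "sum c A"] by auto
qed auto

lemma supported_mult:
  assumes "F \<in> supported S" "G \<in> supported T" "\<And>s t. s \<in> S \<Longrightarrow> t \<in> T \<Longrightarrow> s + t \<in> U"
  shows "F * G \<in> supported U"
proof -
  have "Poly_Mapping.keys (mps_coeff F i * mps_coeff G j) \<subseteq> U" for i j
    using assms keys_mult[of "mps_coeff F i" "mps_coeff G j"] by (fastforce simp: supported_def)
  then have "Poly_Mapping.keys (\<Sum>p\<in>antidiagonal n. mps_coeff F (fst p) * mps_coeff G (snd p)) \<subseteq> U" for n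
    by (intro keys_sum_subset)
  then show ?thesis
    by (simp add: supported_def mps_coeff_mult case_prod_unfold)
qed

lemma supported_prod:
  assumes "0 \<in> S" "\<And>s t. s \<in> S \<Longrightarrow> t \<in> S \<Longrightarrow> s + t \<in> S"
    and "\<And>i. i \<in> A \<Longrightarrow> F i \<in> supported S"
  shows "prod F A \<in> supported S"
  using assms(3)
  by (induction A rule: infinite_finite_induct) (auto intro: supported_mult assms(1,2) simp: assms(1))

lemma supported_const: "Poly_Mapping.keys c \<subseteq> S \<Longrightarrow> mps_const c \<in> supported S"
  by (simp add: supported_def mps_coeff_const)

lemma supported_mps_var: "0 \<in> S \<Longrightarrow> mps_var v \<in> supported S"
  by (simp add: supported_def mps_var_def)

text \<open>Parts with disjoint supports cannot cancel, so a congruence splits into congruences of the parts.\<close>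

lemma supported_disjoint:
  assumes "F \<in> supported S" "G \<in> supported T" "S \<inter> T = {}" "F + G \<in> order_ideal N"
  shows "F \<in> order_ideal N"
  unfolding order_ideal_def
proof clarify
  fix n :: "'a \<Rightarrow>\<^sub>0 nat"
  assume "total_degree n < N"
  then have *: "mps_coeff F n = - mps_coeff G n"
    using assms(4) by (simp add: order_ideal_def eq_neg_iff_add_eq_0)
  then have "Poly_Mapping.keys (mps_coeff F n) \<subseteq> S \<inter> T"
    using assms(1,2) by (simp add: supported_def) (metis keys_minus)
  then show "mps_coeff F n = 0"
    using assms(3) by simp
qed

lemma one_plus_supported_mult:
  assumes "\<And>s t. s \<in> S \<Longrightarrow> t \<in> S \<Longrightarrow> s + t \<in> S"
    and "F - 1 \<in> supported S" "G - 1 \<in> supported S"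
  shows "F * G - 1 \<in> supported S"
proof -
  have *: "F * G - 1 = (F - 1) * (G - 1) + (F - 1) + (G - 1)"
    by (simp add: algebra_simps)
  show ?thesis
    unfolding * by (intro supported_add supported_mult[OF assms(2,3,1)] assms(2,3))
qed

lemma one_plus_supported_prod:
  assumes "\<And>s t. s \<in> S \<Longrightarrow> t \<in> S \<Longrightarrow> s + t \<in> S"
    and "\<And>i. i \<in> A \<Longrightarrow> F i - 1 \<in> supported S"
  shows "prod F A - 1 \<in> supported S"
  using assms(2)
  by (induction A rule: infinite_finite_induct) (auto intro: one_plus_supported_mult assms(1))

lemma one_plus_supported_power:
  assumes "\<And>s t. s \<in> S \<Longrightarrow> t \<in> S \<Longrightarrow> s + t \<in> S"
    and "F - 1 \<in> supported S"
  shows "F ^ n - 1 \<in> supported S"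
  using assms(2) by (induction n) (auto intro: one_plus_supported_mult assms(1))

text \<open>The geometric series: the inverse is the fixed point of \<open>G \<mapsto> 1 + (1 - F) * G\<close>, which the
iteration keeps in \<open>supported (insert 0 S)\<close>. The fixed point equation \<open>G - 1 = (1 - F) * G\<close> then
removes the exponent \<open>0\<close> unless it belongs to \<open>S\<close>.\<close>

lemma one_plus_inverse:
  fixes F :: "('v::finite, laurent) mps"
  assumes S: "\<And>s t. s \<in> S \<Longrightarrow> t \<in> S \<Longrightarrow> s + t \<in> S"
    and F: "F - 1 \<in> supported S" "F - 1 \<in> order_ideal 1"
  obtains G where "F * G = 1" "G - 1 \<in> supported S" "G - 1 \<in> order_ideal 1"
proof -
  let ?C = "{c :: laurent. Poly_Mapping.keys c \<subseteq> insert 0 S}"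
  define \<Phi> where "\<Phi> H i = 1 + (1 - F) * H i" for H :: "unit \<Rightarrow> ('v, laurent) mps" and i
  have F': "1 - F \<in> order_ideal 1" "1 - F \<in> supported S"
    using order_ideal_minus[OF F(2)] supported_minus[OF F(1)] by simp_all
  have contr: "\<Phi> G i - \<Phi> H i \<in> order_ideal (Suc N)" if "\<And>j. G j - H j \<in> order_ideal N" for G H N i
  proof -
    have "\<Phi> G i - \<Phi> H i = (1 - F) * (G i - H i)"
      by (simp add: \<Phi>_def algebra_simps)
    then show ?thesis
      using order_ideal_mult[OF F'(1) that[of i]] by simp
  qed
  have closed: "mps_coeff (\<Phi> H i) n \<in> ?C" if "\<And>j m. mps_coeff (H j) m \<in> ?C" for H i n
  proof -
    have "H i \<in> supported (insert 0 S)"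
      using that by (simp add: supported_def)
    then have "\<Phi> H i \<in> supported (insert 0 S)"
      unfolding \<Phi>_def
      by (intro supported_add supported_mult[OF F'(2)]) (auto intro: S)
    then show ?thesis
      by (simp add: supported_def)
  qed
  have "0 \<in> ?C"
    by simp
  obtain H where H0: "\<And>G. \<Phi> G = G \<longleftrightarrow> G = H" and H2: "\<And>i n. mps_coeff (H i) n \<in> ?C"
    by (rule contraction_fixed_point[of \<Phi>, OF contr \<open>0 \<in> ?C\<close> closed]) auto
  have H: "\<Phi> H = H" "\<And>n. Poly_Mapping.keys (mps_coeff (H ()) n) \<subseteq> insert 0 S"
    using H0 H2 by auto
  define G where "G = H ()"
  have G: "G - 1 = (1 - F) * G"
    using fun_cong[OF H(1), of "()"] by (simp add: \<Phi>_def G_def algebra_simps)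
  show thesis
  proof
    show "F * G = 1"
      using G by (simp add: algebra_simps)
    have "G \<in> supported (insert 0 S)"
      using H(2) by (simp add: supported_def G_def)
    then show "G - 1 \<in> supported S"
      unfolding G by (intro supported_mult[OF F'(2)]) (auto intro: S)
    show "G - 1 \<in> order_ideal 1"
      unfolding G by (rule order_ideal_mult_right[OF F'(1)])
  qed
qed

lemma inverse_mps_eq:
  fixes F :: "('v, 'a::comm_ring_1) mps"
  assumes "F * G = 1"
  shows "inverse F = G"
proof -
  have "H = G" if "F * H = 1" for H
  proof -
    have "H = (F * G) * H"
      using assms by simp
    also have "\<dots> = (F * H) * G"
      by (simp only: mult_ac)
    finally show ?thesis
      using that by simp
  qed
  then have "(THE H. F * H = 1) = G"
    using assms by blast
  moreover have "F dvd 1"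
    using assms by (metis dvd_triv_left)
  ultimately show ?thesis
    by (simp add: inverse_mps_def)
qed

text \<open>Writing an integer exponent as a difference of natural numbers makes the laws for powers of a unit
independent of signs.\<close>

lemma power_int_unit_diff:
  fixes F :: "('v, 'a::comm_ring_1) mps"
  assumes "F * G = 1"
  shows "F powi (int i - int j) = F ^ i * G ^ j"
proof (cases "j \<le> i")
  case True
  then have "F ^ i * G ^ j = F ^ (i - j) * (F * G) ^ j"
    by (simp add: power_mult_distrib mult.assoc[symmetric] power_add[symmetric])
  then show ?thesis
    using True assms by (simp add: power_int_def nat_diff_distrib)
next
  case False
  then have "F ^ i * G ^ j = (F * G) ^ i * G ^ (j - i)"
    by (simp add: power_mult_distrib mult.assoc power_add[symmetric])
  moreover have "nat (int j - int i) = j - i"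
    by simp
  ultimately show ?thesis
    using False assms by (simp add: power_int_def inverse_mps_eq)
qed

lemma power_int_unit_add:
  fixes F :: "('v, 'a::comm_ring_1) mps"
  assumes "F * G = 1"
  shows "F powi (m + n) = F powi m * F powi n"
proof -
  obtain i j where m: "m = int i - int j"
    using int_diff_cases by blast
  obtain i' j' where n: "n = int i' - int j'"
    using int_diff_cases by blast
  have "m + n = int (i + i') - int (j + j')"
    by (simp add: m n)
  then show ?thesis
    unfolding m n by (simp only: power_int_unit_diff[OF assms] power_add mult_ac)
qed

lemma power_int_unit_minus:
  fixes F :: "('v, 'a::comm_ring_1) mps"
  assumes "F * G = 1"
  shows "F powi n * F powi (- n) = 1"
  using power_int_unit_add[OF assms, of n "- n"] by simp

lemma power_int_inverse_unit:
  fixes F :: "('v, 'a::comm_ring_1) mps"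
  assumes "F * G = 1"
  shows "G powi n = F powi (- n)"
proof -
  have inv: "inverse F = G" "inverse G = F"
    using assms by (simp_all add: inverse_mps_eq mult.commute)
  show ?thesis
    unfolding power_int_def inv by auto
qed

section \<open>Continuous endomorphisms of \<open>B\<close>\<close>

definition monomial :: "int \<times> int \<Rightarrow> ('v, laurent) mps" where
  "monomial u = mps_const (Poly_Mapping.single u 1)"

definition scalar :: "rat \<Rightarrow> ('v, laurent) mps" where
  "scalar q = mps_const (Poly_Mapping.single 0 q)"

lemma monomial_zero [simp]: "monomial 0 = 1"
  by (simp add: monomial_def)

lemma monomial_mult: "monomial u * monomial w = monomial (u + w)"
  by (simp add: monomial_def mult_single flip: mps_const_mult)

lemma monomial_uminus_mult [simp]: "monomial u * monomial (- u) = 1" "monomial (- u) * monomial u = 1"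
  by (simp_all add: monomial_mult)

lemma supported_monomial: "u \<in> S \<Longrightarrow> monomial u \<in> supported S"
  by (auto simp: monomial_def intro!: supported_const)

lemma scalar_add: "scalar (p + q) = scalar p + scalar q"
  by (simp add: scalar_def single_add flip: mps_const_add)

lemma scalar_mult: "scalar p * scalar q = scalar (p * q)"
  by (simp add: scalar_def mult_single flip: mps_const_mult)

lemma scalar_zero [simp]: "scalar 0 = 0"
  by (simp add: scalar_def)

lemma scalar_one [simp]: "scalar 1 = 1"
  by (simp add: scalar_def)

lemma supported_scalar: "0 \<in> S \<Longrightarrow> scalar q \<in> supported S"
  by (auto simp: scalar_def intro!: supported_const split: if_splits)

lemma laurent_eq_sum_single:
  "c = (\<Sum>u\<in>Poly_Mapping.keys c. Poly_Mapping.single u (Poly_Mapping.lookup c u))"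
  by (rule poly_mapping_eqI) (simp add: lookup_sum lookup_single when_def in_keys_iff)

lemma mps_const_eq_sum_monomials:
  "mps_const c = (\<Sum>u\<in>Poly_Mapping.keys c. scalar (Poly_Mapping.lookup c u) * monomial u)"
proof -
  have "mps_const c = mps_const (\<Sum>u\<in>Poly_Mapping.keys c. Poly_Mapping.single u (Poly_Mapping.lookup c u))"
    by (simp flip: laurent_eq_sum_single)
  also have "\<dots> = (\<Sum>u\<in>Poly_Mapping.keys c. scalar (Poly_Mapping.lookup c u) * monomial u)"
    by (simp add: mps_const_sum scalar_def monomial_def mult_single flip: mps_const_mult)
  finally show ?thesis .
qed

lemma of_R_mps_var: "of_R (mps_var v) = mps_var v"
  by (rule mps_eqI) (simp add: of_R_def mps_var_def)

lemma of_R_mps_const: "of_R (mps_const q) = scalar q"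
  by (rule mps_eqI) (simp add: of_R_def mps_const_def scalar_def)

definition R_endomorphism :: "(('k, 'l) B_ring \<Rightarrow> ('k, 'l) B_ring) \<Rightarrow> bool" where
  "R_endomorphism \<phi> \<longleftrightarrow> \<phi> 1 = 1 \<and> (\<forall>F G. \<phi> (F + G) = \<phi> F + \<phi> G) \<and>
     (\<forall>F G. \<phi> (F * G) = \<phi> F * \<phi> G) \<and> (\<forall>r F. \<phi> (of_R r * F) = of_R r * \<phi> F)"

lemma R_automorphisms_iff: "\<phi> \<in> R_automorphisms \<longleftrightarrow> bij \<phi> \<and> R_endomorphism \<phi>"
  by (auto simp: R_automorphisms_def R_endomorphism_def)

lemma R_endomorphism_id: "R_endomorphism id"
  by (simp add: R_endomorphism_def)

lemma R_endomorphism_comp: "R_endomorphism \<phi> \<Longrightarrow> R_endomorphism \<psi> \<Longrightarrow> R_endomorphism (\<phi> \<circ> \<psi>)"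
  unfolding R_endomorphism_def comp_apply by metis

context
  fixes \<phi> :: "('k::finite, 'l::finite) B_ring \<Rightarrow> ('k, 'l) B_ring"
  assumes \<phi>: "R_endomorphism \<phi>"
begin

lemma endo_one: "\<phi> 1 = 1"
  and endo_add: "\<phi> (F + G) = \<phi> F + \<phi> G"
  and endo_mult: "\<phi> (F * G) = \<phi> F * \<phi> G"
  and endo_of_R_mult: "\<phi> (of_R r * F) = of_R r * \<phi> F"
  using \<phi> unfolding R_endomorphism_def by blast+

lemma endo_zero: "\<phi> 0 = 0"
  using endo_add[of 0 0] by simp

lemma endo_diff: "\<phi> (F - G) = \<phi> F - \<phi> G"
  using endo_add[of "F - G" G] by (simp add: algebra_simps)

lemma endo_sum: "\<phi> (sum F A) = (\<Sum>i\<in>A. \<phi> (F i))"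
  by (induction A rule: infinite_finite_induct) (simp_all add: endo_zero endo_add)

lemma endo_prod: "\<phi> (prod F A) = (\<Prod>i\<in>A. \<phi> (F i))"
  by (induction A rule: infinite_finite_induct) (simp_all add: endo_one endo_mult)

lemma endo_mps_var: "\<phi> (mps_var v) = mps_var v"
  using endo_of_R_mult[of "mps_var v" 1] by (simp add: of_R_mps_var endo_one)

lemma endo_scalar: "\<phi> (scalar q) = scalar q"
  using endo_of_R_mult[of "mps_const q" 1] by (simp add: of_R_mps_const endo_one)

text \<open>Continuity is automatic: an element of the ideal is a combination of variables, which an
\<open>R\<close>-linear map leaves in place.\<close>

lemma endo_order_ideal: "F \<in> order_ideal N \<Longrightarrow> \<phi> F \<in> order_ideal N"
proof (induction N arbitrary: F)
  case (Suc N)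
  obtain F' where F: "F = mps_const (mps_coeff F 0) + (\<Sum>v\<in>UNIV. mps_var v * F' v)"
    and F': "\<And>N v. F \<in> order_ideal (Suc N) \<Longrightarrow> F' v \<in> order_ideal N"
    by (rule mps_decompose[of F]) auto
  have "mps_coeff F 0 = 0"
    using Suc.prems by (simp add: order_ideal_def)
  then have F0: "F = (\<Sum>v\<in>UNIV. mps_var v * F' v)"
    using F by simp
  have "\<phi> F = (\<Sum>v\<in>UNIV. mps_var v * \<phi> (F' v))"
    by (subst F0) (simp add: endo_sum endo_mult endo_mps_var)
  moreover have "mps_var v * \<phi> (F' v) \<in> order_ideal (1 + N)" for v
    by (rule order_ideal_mult[OF mps_var_in_order_ideal Suc.IH[OF F'[OF Suc.prems]]])
  ultimately show ?case
    by (auto intro: order_ideal_sum)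
qed simp

end

text \<open>Agreement on the Laurent monomials gives agreement on constants, and each application of
\<open>mps_decompose\<close> then gains one power of the ideal for the difference \<open>\<phi> F - \<psi> F\<close>.\<close>

lemma R_endomorphism_eqI_monomials:
  fixes \<phi> \<psi> :: "('k::finite, 'l::finite) B_ring \<Rightarrow> ('k, 'l) B_ring"
  assumes \<phi>: "R_endomorphism \<phi>" and \<psi>: "R_endomorphism \<psi>"
    and eq: "\<And>u. \<phi> (monomial u) = \<psi> (monomial u)"
  shows "\<phi> = \<psi>"
proof
  fix F
  have const: "\<phi> (mps_const c) = \<psi> (mps_const c)" for c
    unfolding mps_const_eq_sum_monomials
    by (simp add: endo_sum[OF \<phi>] endo_sum[OF \<psi>] endo_mult[OF \<phi>] endo_mult[OF \<psi>]
        endo_scalar[OF \<phi>] endo_scalar[OF \<psi>] eq)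
  have "\<phi> F - \<psi> F \<in> order_ideal N" for N
  proof (induction N arbitrary: F)
    case (Suc N)
    obtain F' where F: "F = mps_const (mps_coeff F 0) + (\<Sum>v\<in>UNIV. mps_var v * F' v)"
      by (rule mps_decompose[of F]) auto
    have "\<phi> F - \<psi> F = (\<Sum>v\<in>UNIV. mps_var v * (\<phi> (F' v) - \<psi> (F' v)))"
      by (subst (1 2) F) (simp add: endo_add[OF \<phi>] endo_add[OF \<psi>] endo_sum[OF \<phi>] endo_sum[OF \<psi>]
          endo_mult[OF \<phi>] endo_mult[OF \<psi>] endo_mps_var[OF \<phi>] endo_mps_var[OF \<psi>] const
          right_diff_distrib sum_subtractf)
    moreover have "mps_var v * (\<phi> (F' v) - \<psi> (F' v)) \<in> order_ideal (1 + N)" for v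
      by (rule order_ideal_mult[OF mps_var_in_order_ideal Suc.IH])
    ultimately show ?case
      by (auto intro: order_ideal_sum)
  qed simp
  then show "\<phi> F = \<psi> F"
    using order_ideal_Inter[of "\<phi> F - \<psi> F"] by simp
qed

lemma R_endomorphism_eqI:
  fixes \<phi> \<psi> :: "('k::finite, 'l::finite) B_ring \<Rightarrow> ('k, 'l) B_ring"
  assumes \<phi>: "R_endomorphism \<phi>" and \<psi>: "R_endomorphism \<psi>"
    and x: "\<phi> x_var = \<psi> x_var" and y: "\<phi> y_var = \<psi> y_var"
  shows "\<phi> = \<psi>"
proof (rule R_endomorphism_eqI_monomials[OF \<phi> \<psi>])
  let ?P = "\<lambda>u. \<phi> (monomial u) = \<psi> (monomial u)"
  have add: "?P (u + w)" if "?P u" "?P w" for u w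
    using that by (simp add: endo_mult[OF \<phi>] endo_mult[OF \<psi>] flip: monomial_mult)
  have minus: "?P (- u)" if "?P u" for u
  proof -
    have "\<phi> (monomial (- u)) = \<phi> (monomial (- u)) * \<psi> (monomial u * monomial (- u))"
      by (simp add: endo_one[OF \<psi>])
    also have "\<dots> = \<phi> (monomial (- u) * monomial u) * \<psi> (monomial (- u))"
      using that by (simp only: endo_mult[OF \<phi>] endo_mult[OF \<psi>] mult_ac)
    finally show ?thesis
      by (simp add: endo_one[OF \<phi>])
  qed
  have P0: "?P 0"
    by (simp add: endo_one[OF \<phi>] endo_one[OF \<psi>])
  have multiple: "?P (i * p, i * q)" if "?P (p, q)" for i p q
  proof (induction i rule: int_induct[where k = 0])
    case base
    then show ?case
      using P0 by (simp add: zero_prod_def)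
  next
    case (step1 i)
    then show ?case
      using add[OF step1(2) that] by (simp add: distrib_right)
  next
    case (step2 i)
    then show ?case
      using add[OF step2(2) minus[OF that]] by (simp add: left_diff_distrib)
  qed
  fix u
  have "?P (1, 0)" "?P (0, 1)"
    using x y by (simp_all add: monomial_def x_var_def y_var_def)
  then have "?P ((fst u * 1, fst u * 0) + (snd u * 0, snd u * 1))"
    by (intro add multiple)
  also have "(fst u * 1, fst u * 0) + (snd u * 0, snd u * 1) = u"
    by (simp add: prod_eq_iff)
  finally show "?P u" .
qed

section \<open>Substitution of units for the Laurent monomials\<close>

text \<open>The \<open>\<rat>\<close>-linear map that sends \<open>x\<^sup>i y\<^sup>j\<close> to \<open>e (i, j)\<close>, and its extension to series
\<open>F = \<Sum>p. F\<^sub>p v\<^sup>p\<close> by \<open>F \<mapsto> \<Sum>p. laurent_subst e F\<^sub>p * v\<^sup>p\<close>. It is a ring homomorphism as soon as \<open>e\<close>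
is one from \<open>\<int>\<^sup>2\<close> to the units.\<close>

definition laurent_subst :: "(int \<times> int \<Rightarrow> ('v, laurent) mps) \<Rightarrow> laurent \<Rightarrow> ('v, laurent) mps" where
  "laurent_subst e c = (\<Sum>u\<in>Poly_Mapping.keys c. scalar (Poly_Mapping.lookup c u) * e u)"

definition series_subst :: "(int \<times> int \<Rightarrow> ('v, laurent) mps) \<Rightarrow> ('v, laurent) mps \<Rightarrow> ('v, laurent) mps" where
  "series_subst e F =
     Abs_mps (\<lambda>n. \<Sum>(p, q)\<in>antidiagonal n. mps_coeff (laurent_subst e (mps_coeff F p)) q)"

lemma mps_coeff_series_subst:
  "mps_coeff (series_subst e F) n =
     (\<Sum>(p, q)\<in>antidiagonal n. mps_coeff (laurent_subst e (mps_coeff F p)) q)"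
  by (simp add: series_subst_def)

lemma laurent_subst_superset:
  assumes "finite A" "Poly_Mapping.keys c \<subseteq> A"
  shows "laurent_subst e c = (\<Sum>u\<in>A. scalar (Poly_Mapping.lookup c u) * e u)"
  unfolding laurent_subst_def using assms
  by (intro sum.mono_neutral_left) (auto simp: in_keys_iff)

lemma laurent_subst_add: "laurent_subst e (c + d) = laurent_subst e c + laurent_subst e d"
proof -
  let ?A = "Poly_Mapping.keys c \<union> Poly_Mapping.keys d"
  show ?thesis
    using Poly_Mapping.keys_add[of c d]
    by (simp add: laurent_subst_superset[of ?A] lookup_add scalar_add distrib_right sum.distrib)
qed

lemma laurent_subst_zero [simp]: "laurent_subst e 0 = 0"
  by (simp add: laurent_subst_def)

lemma laurent_subst_sum: "laurent_subst e (sum c A) = (\<Sum>i\<in>A. laurent_subst e (c i))"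
  by (induction A rule: infinite_finite_induct) (simp_all add: laurent_subst_add)

lemma laurent_subst_single: "laurent_subst e (Poly_Mapping.single u q) = scalar q * e u"
  by (cases "q = 0") (simp_all add: laurent_subst_def)

lemma laurent_subst_mult:
  fixes c d :: laurent
  assumes "\<And>u w. e (u + w) = e u * e w"
  shows "laurent_subst e (c * d) = laurent_subst e c * laurent_subst e d"
proof -
  let ?s = "\<lambda>c u. Poly_Mapping.single u (Poly_Mapping.lookup c u) :: laurent"
  have "laurent_subst e (c * d) =
      laurent_subst e ((\<Sum>u\<in>Poly_Mapping.keys c. ?s c u) * (\<Sum>w\<in>Poly_Mapping.keys d. ?s d w))"
    by (simp flip: laurent_eq_sum_single)
  also have "\<dots> = (\<Sum>u\<in>Poly_Mapping.keys c. \<Sum>w\<in>Poly_Mapping.keys d.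
      (scalar (Poly_Mapping.lookup c u) * e u) * (scalar (Poly_Mapping.lookup d w) * e w))"
    by (simp add: sum_product laurent_subst_sum mult_single laurent_subst_single assms mult_ac
        flip: scalar_mult)
  also have "\<dots> = laurent_subst e c * laurent_subst e d"
    by (simp add: laurent_subst_def sum_product)
  finally show ?thesis .
qed

lemma series_subst_const: "series_subst e (mps_const c) = laurent_subst e c"
  by (rule mps_eqI, unfold mps_coeff_series_subst, subst sum_antidiagonal_left_zero)
    (auto simp: mps_coeff_const)

lemma series_subst_add: "series_subst e (F + G) = series_subst e F + series_subst e G"
  by (rule mps_eqI)
    (simp add: mps_coeff_series_subst laurent_subst_add case_prod_unfold sum.distrib)

lemma series_subst_zero [simp]: "series_subst e 0 = 0"
  using series_subst_const[of e 0] by simp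

lemma series_subst_sum: "series_subst e (sum F A) = (\<Sum>i\<in>A. series_subst e (F i))"
  by (induction A rule: infinite_finite_induct) (simp_all add: series_subst_add)

text \<open>On the coefficient of \<open>n\<close> this is the shift \<open>p \<mapsto> v + p\<close> of the first component of the decompositions
of \<open>n\<close>; decompositions whose first component lacks \<open>v\<close> contribute nothing.\<close>

lemma series_subst_var_mult: "series_subst e (mps_var v * F) = mps_var v * series_subst e F"
proof (rule mps_eqI)
  fix n
  let ?s = "Poly_Mapping.single v (1::nat)"
  let ?h = "\<lambda>p q. mps_coeff (laurent_subst e (mps_coeff (mps_var v * F) p)) q"
  show "mps_coeff (series_subst e (mps_var v * F)) n = mps_coeff (mps_var v * series_subst e F) n"
  proof (cases "Poly_Mapping.lookup n v = 0")
    case True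
    have "?h p q = 0" if "(p, q) \<in> antidiagonal n" for p q
    proof -
      have "Poly_Mapping.lookup p v = 0"
        using that True by (auto simp: antidiagonal_def lookup_add)
      then show ?thesis
        by (simp add: mps_coeff_var_mult)
    qed
    then show ?thesis
      using True by (auto simp: mps_coeff_series_subst mps_coeff_var_mult intro!: sum.neutral)
  next
    case False
    define m where "m = n - ?s"
    have n: "n = ?s + m"
      using single_add_minus[OF False] by (simp add: m_def)
    let ?A = "(\<lambda>(p, q). (?s + p, q)) ` antidiagonal m"
    have "(\<Sum>(p, q)\<in>antidiagonal n. ?h p q) = (\<Sum>(p, q)\<in>?A. ?h p q)"
    proof (rule sum.mono_neutral_right)
      show "?A \<subseteq> antidiagonal n"
        by (auto simp: antidiagonal_def n add.assoc)
      have "?h p q = 0" if pq: "(p, q) \<in> antidiagonal n" "(p, q) \<notin> ?A" for p q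
      proof -
        have "Poly_Mapping.lookup p v = 0"
        proof (rule ccontr)
          assume "Poly_Mapping.lookup p v \<noteq> 0"
          then have p: "p = ?s + (p - ?s)"
            using single_add_minus[of p v] by simp
          have "?s + ((p - ?s) + q) = ?s + m"
            using pq(1) p n by (simp add: antidiagonal_def flip: add.assoc)
          then have "(p - ?s, q) \<in> antidiagonal m"
            by (simp add: antidiagonal_def)
          then have "(?s + (p - ?s), q) \<in> ?A"
            by force
          then show False
            using pq(2) p by simp
        qed
        then show ?thesis
          by (simp add: mps_coeff_var_mult)
      qed
      then show "\<forall>x\<in>antidiagonal n - ?A. (case x of (p, q) \<Rightarrow> ?h p q) = 0"
        by (simp only: split_paired_all Ball_def Diff_iff prod.case) simp
    qed simp
    also have "\<dots> = (\<Sum>(p, q)\<in>antidiagonal m. mps_coeff (laurent_subst e (mps_coeff F p)) q)"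
      by (subst sum.reindex)
        (auto simp: inj_on_def case_prod_unfold mps_coeff_var_mult_add simp del: One_nat_def
          intro!: sum.cong)
    also have "\<dots> = mps_coeff (mps_var v * series_subst e F) n"
      unfolding n mps_coeff_var_mult_add by (simp add: mps_coeff_series_subst)
    finally show ?thesis
      by (simp add: mps_coeff_series_subst)
  qed
qed

text \<open>Expanding both factors by \<open>mps_decompose\<close>, the defect of multiplicativity of \<open>F * G\<close> becomes a
combination, with variables as coefficients, of defects of other products, because it vanishes for
two constants. Hence it lies in every power of the ideal.\<close>

lemma series_subst_mult:
  fixes F G :: "('v::finite, laurent) mps"
  assumes e: "\<And>u w. e (u + w) = e u * e w"
  shows "series_subst e (F * G) = series_subst e F * series_subst e G"
proof -
  let ?S = "series_subst e"
  have *: "?S (F * G) - ?S F * ?S G \<in> order_ideal N" for N F G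
  proof (induction N arbitrary: F G)
    case (Suc N)
    obtain F' where F: "F = mps_const (mps_coeff F 0) + (\<Sum>v\<in>UNIV. mps_var v * F' v)"
      by (rule mps_decompose[of F]) auto
    obtain G' where G: "G = mps_const (mps_coeff G 0) + (\<Sum>v\<in>UNIV. mps_var v * G' v)"
      by (rule mps_decompose[of G]) auto
    let ?c = "mps_const (mps_coeff F 0)" and ?d = "mps_const (mps_coeff G 0)"
    have FG: "F * G = ?c * ?d + (\<Sum>v\<in>UNIV. mps_var v * (?c * G' v)) + (\<Sum>v\<in>UNIV. mps_var v * (F' v * G))"
      (is "_ = ?R")
    proof -
      have "F * G = ?c * G + (\<Sum>v\<in>UNIV. mps_var v * F' v) * G"
        by (subst F) (simp add: distrib_right)
      also have "?c * G = ?c * ?d + (\<Sum>v\<in>UNIV. mps_var v * (?c * G' v))"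
        by (subst G) (simp add: distrib_left sum_distrib_left mult_ac)
      finally show ?thesis
        by (simp add: sum_distrib_right mult.assoc)
    qed
    have SF: "?S F = ?S ?c + (\<Sum>v\<in>UNIV. mps_var v * ?S (F' v))"
      by (subst F) (simp add: series_subst_add series_subst_sum series_subst_var_mult)
    have SG: "?S G = ?S ?d + (\<Sum>v\<in>UNIV. mps_var v * ?S (G' v))"
      by (subst G) (simp add: series_subst_add series_subst_sum series_subst_var_mult)
    have cd: "?S (?c * ?d) = ?S ?c * ?S ?d"
      by (simp add: series_subst_const laurent_subst_mult[OF e] flip: mps_const_mult)
    have "?S (F * G) - ?S F * ?S G =
        ?S (F * G) - (?S ?c * ?S ?d + (\<Sum>v\<in>UNIV. mps_var v * (?S ?c * ?S (G' v)))
          + (\<Sum>v\<in>UNIV. mps_var v * (?S (F' v) * ?S G)))"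
    proof -
      have "?S F * ?S G = ?S ?c * ?S G + (\<Sum>v\<in>UNIV. mps_var v * (?S (F' v) * ?S G))"
        by (subst SF) (simp add: distrib_right sum_distrib_right mult.assoc)
      also have "?S ?c * ?S G = ?S ?c * ?S ?d + (\<Sum>v\<in>UNIV. mps_var v * (?S ?c * ?S (G' v)))"
        by (subst SG) (simp add: distrib_left sum_distrib_left mult_ac)
      finally show ?thesis
        by simp
    qed
    also have "\<dots> = (\<Sum>v\<in>UNIV. mps_var v * (?S (?c * G' v) - ?S ?c * ?S (G' v)))
        + (\<Sum>v\<in>UNIV. mps_var v * (?S (F' v * G) - ?S (F' v) * ?S G))"
      unfolding FG
      by (simp add: series_subst_add series_subst_sum series_subst_var_mult cd
          right_diff_distrib sum_subtractf)
    also have "\<dots> \<in> order_ideal (1 + N)"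
      by (intro order_ideal_add order_ideal_sum order_ideal_mult[OF mps_var_in_order_ideal] Suc.IH)
    finally show ?case
      by simp
  qed simp
  from order_ideal_Inter[OF this, of F G] show ?thesis
    by simp
qed

lemma R_endomorphism_series_subst:
  fixes e :: "int \<times> int \<Rightarrow> ('k::finite, 'l::finite) B_ring"
  assumes e0: "e 0 = 1" and e: "\<And>u w. e (u + w) = e u * e w"
  shows "R_endomorphism (series_subst e)"
proof -
  have "series_subst e (of_R r) = of_R r" for r
  proof (rule mps_eqI)
    fix n
    have *: "laurent_subst e (mps_coeff (of_R r) p) = scalar (mps_coeff r p)" for p
      by (simp add: of_R_def laurent_subst_single e0)
    show "mps_coeff (series_subst e (of_R r)) n = mps_coeff (of_R r) n"
      unfolding mps_coeff_series_subst *
      by (subst sum_antidiagonal_right_zero) (auto simp: scalar_def of_R_def mps_coeff_const)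
  qed
  moreover have "series_subst e 1 = 1"
    using series_subst_const[of e 1] laurent_subst_single[of e 0 1] by (simp add: e0)
  ultimately show ?thesis
    by (simp add: R_endomorphism_def series_subst_add series_subst_mult[OF e])
qed

lemma series_subst_monomial: "series_subst e (monomial u) = e u"
  by (simp add: monomial_def series_subst_const laurent_subst_single)

text \<open>How far a substitution is from the identity can be read off from the monomials. With \<open>T = {}\<close> this
also shows that the substitution fixes series in monomials that it fixes.\<close>

lemma supported_series_subst_diff:
  assumes F: "F \<in> supported S"
    and e: "\<And>u. u \<in> S \<Longrightarrow> e u - monomial u \<in> supported T"
  shows "series_subst e F - F \<in> supported T"
proof -
  have c: "laurent_subst e (mps_coeff F p) - mps_const (mps_coeff F p) \<in> supported T" for p
  proof -
    have "laurent_subst e (mps_coeff F p) - mps_const (mps_coeff F p) =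
        (\<Sum>u\<in>Poly_Mapping.keys (mps_coeff F p). scalar (Poly_Mapping.lookup (mps_coeff F p) u) * (e u - monomial u))"
      by (simp add: laurent_subst_def mps_const_eq_sum_monomials[of "mps_coeff F p"]
          right_diff_distrib sum_subtractf)
    moreover have "scalar q * (e u - monomial u) \<in> supported T" if "u \<in> Poly_Mapping.keys (mps_coeff F p)" for u q
      by (rule supported_mult[OF supported_scalar[of "{0}"] e]) (use F that in \<open>auto simp: supported_def\<close>)
    ultimately show ?thesis
      by (simp add: supported_sum)
  qed
  have "mps_coeff (series_subst e F - F) n = (\<Sum>(p, q)\<in>antidiagonal n.
      mps_coeff (laurent_subst e (mps_coeff F p) - mps_const (mps_coeff F p)) q)" for n
  proof -
    have "mps_coeff F n = (\<Sum>(p, q)\<in>antidiagonal n. mps_coeff (mps_const (mps_coeff F p)) q)"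
      by (subst sum_antidiagonal_right_zero) (auto simp: mps_coeff_const)
    then show ?thesis
      by (simp add: mps_coeff_series_subst case_prod_unfold sum_subtractf)
  qed
  then show ?thesis
    using c by (auto simp: supported_def case_prod_unfold simp del: mps_coeff_diff
        intro!: keys_sum_subset)
qed

section \<open>The automorphisms \<open>T\<^bsub>(a,b),f\<^esub>\<close>\<close>

text \<open>The exponents of the monomials in \<open>x\<^sup>a y\<^sup>b \<rat>[x\<^sup>a y\<^sup>b]\<close>.\<close>

definition ray :: "int \<Rightarrow> int \<Rightarrow> (int \<times> int) set" where
  "ray a b = {(int i * a, int i * b) | i. i \<ge> 1}"

lemma ray_add: "u \<in> ray a b \<Longrightarrow> w \<in> ray a b \<Longrightarrow> u + w \<in> ray a b"
  unfolding ray_def by (auto simp flip: distrib_right of_nat_add intro: trans_le_add1)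

lemma tv_series_iff:
  "f \<in> tv_series a b \<longleftrightarrow> f - 1 \<in> supported (ray a b) \<and> f - 1 \<in> order_ideal 1"
  for f :: "('k::finite, 'l::finite) B_ring"
proof
  assume "f \<in> tv_series a b"
  then have f0: "mps_coeff f 0 = 1"
    and f: "n \<noteq> 0 \<Longrightarrow> Poly_Mapping.keys (mps_coeff f n) \<subseteq> ray a b" for n
    by (auto simp: tv_series_def ray_def)
  have "Poly_Mapping.keys (mps_coeff (f - 1) n) \<subseteq> ray a b" for n
    using f0 f[of n] by (cases "n = 0") (auto simp: mps_coeff_one)
  then show "f - 1 \<in> supported (ray a b) \<and> f - 1 \<in> order_ideal 1"
    using f0 unfolding order_ideal_1_iff by (simp add: supported_def mps_coeff_one)
next
  assume f: "f - 1 \<in> supported (ray a b) \<and> f - 1 \<in> order_ideal 1"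
  then have "mps_coeff f 0 = 1"
    unfolding order_ideal_1_iff by (simp add: mps_coeff_one)
  moreover have "Poly_Mapping.keys (mps_coeff f n) \<subseteq> ray a b" if "n \<noteq> 0" for n
  proof -
    have "Poly_Mapping.keys (mps_coeff (f - 1) n) \<subseteq> ray a b"
      using f unfolding supported_def by blast
    then show ?thesis
      using that by (simp add: mps_coeff_one)
  qed
  ultimately show "f \<in> tv_series a b"
    unfolding tv_series_def ray_def by auto
qed

lemma tv_series_inverse:
  fixes f :: "('k::finite, 'l::finite) B_ring"
  assumes "f \<in> tv_series a b"
  obtains g where "g \<in> tv_series a b" "f * g = 1"
  using one_plus_inverse[of "ray a b" f] assms ray_add unfolding tv_series_iff by metis

lemma tv_series_powi:
  fixes f :: "('k::finite, 'l::finite) B_ring"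
  assumes "f \<in> tv_series a b"
  shows "f powi n - 1 \<in> supported (ray a b)"
proof -
  obtain g where "g \<in> tv_series a b" "f * g = 1"
    using tv_series_inverse[OF assms] .
  then show ?thesis
    using assms by (auto simp: power_int_def inverse_mps_eq tv_series_iff
        intro: one_plus_supported_power ray_add)
qed

text \<open>The exponent is forced by \<open>x \<mapsto> x f\<^bsup>-b\<^esup>\<close> and \<open>y \<mapsto> y f\<^sup>a\<close>: the monomial \<open>x\<^sup>i y\<^sup>j\<close> acquires the factor
\<open>f\<close> to the power \<open>a j - b i\<close>.\<close>

definition tv_hom :: "int \<Rightarrow> int \<Rightarrow> ('k, 'l) B_ring \<Rightarrow> ('k, 'l) B_ring \<Rightarrow> ('k, 'l) B_ring" where
  "tv_hom a b f = series_subst (\<lambda>u. monomial u * f powi (a * snd u - b * fst u))"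

lemma tv_hom_monomial: "tv_hom a b f (monomial u) = monomial u * f powi (a * snd u - b * fst u)"
  by (simp add: tv_hom_def series_subst_monomial)

lemma R_endomorphism_tv_hom:
  fixes f :: "('k::finite, 'l::finite) B_ring"
  assumes "f \<in> tv_series a b"
  shows "R_endomorphism (tv_hom a b f)"
  unfolding tv_hom_def
proof (rule R_endomorphism_series_subst)
  obtain g where g: "f * g = 1"
    using tv_series_inverse[OF assms] by blast
  fix u w :: "int \<times> int"
  have "a * snd (u + w) - b * fst (u + w) = (a * snd u - b * fst u) + (a * snd w - b * fst w)"
    by (simp add: algebra_simps)
  then show "monomial (u + w) * f powi (a * snd (u + w) - b * fst (u + w)) =
      monomial u * f powi (a * snd u - b * fst u) * (monomial w * f powi (a * snd w - b * fst w))"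
    by (simp add: power_int_unit_add[OF g] mult_ac flip: monomial_mult)
qed simp

lemma tv_hom_supported:
  fixes f :: "('k::finite, 'l::finite) B_ring"
  assumes f: "f \<in> tv_series a b" and F: "F \<in> supported S"
    and T: "\<And>s r. s \<in> S \<Longrightarrow> r \<in> ray a b \<Longrightarrow> s + r \<in> T"
  shows "tv_hom a b f F - F \<in> supported T"
  unfolding tv_hom_def
proof (rule supported_series_subst_diff[OF F])
  fix u
  assume "u \<in> S"
  then have "monomial u * (f powi (a * snd u - b * fst u) - 1) \<in> supported T"
    by (intro supported_mult[OF supported_monomial[of u "{u}"] tv_series_powi[OF f]]) (auto intro: T)
  then show "monomial u * f powi (a * snd u - b * fst u) - monomial u \<in> supported T"
    by (simp add: right_diff_distrib)
qed

lemma tv_hom_fixes: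
  assumes F: "F \<in> supported {u. a * snd u = b * fst u}"
  shows "tv_hom a b f F = F"
proof -
  have "tv_hom a b f F - F \<in> supported {}"
    unfolding tv_hom_def by (rule supported_series_subst_diff[OF F]) simp
  then have "tv_hom a b f F - F = 0"
    by (intro mps_eqI) (simp add: supported_def)
  then show ?thesis
    by simp
qed

text \<open>The substitution fixes \<open>x\<^sup>a y\<^sup>b\<close>, therefore also \<open>f\<close> and its inverse \<open>g\<close>, so that applying it after the
substitution for \<open>g\<close> just multiplies the powers of \<open>f\<close> and \<open>g\<close>.\<close>

lemma tv_hom_inverse:
  fixes f g :: "('k::finite, 'l::finite) B_ring"
  assumes f: "f \<in> tv_series a b" and g: "g \<in> tv_series a b" and fg: "f * g = 1"
  shows "tv_hom a b f \<circ> tv_hom a b g = id"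
proof (rule R_endomorphism_eqI_monomials)
  fix u
  let ?n = "a * snd u - b * fst u"
  have "g powi ?n \<in> supported {u. a * snd u = b * fst u}"
  proof -
    have "g powi ?n - 1 \<in> supported {u. a * snd u = b * fst u}"
      by (rule supported_mono[OF tv_series_powi[OF g]]) (auto simp: ray_def)
    from supported_add[OF this supported_one] show ?thesis
      by simp
  qed
  then have "tv_hom a b f (g powi ?n) = g powi ?n"
    by (rule tv_hom_fixes)
  then show "(tv_hom a b f \<circ> tv_hom a b g) (monomial u) = id (monomial u)"
    using power_int_unit_minus[OF fg, of ?n]
    by (simp add: tv_hom_monomial endo_mult[OF R_endomorphism_tv_hom[OF f]]
        power_int_inverse_unit[OF fg] mult.assoc)
qed (auto intro!: R_endomorphism_comp R_endomorphism_tv_hom R_endomorphism_id f g)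

text \<open>This justifies the definite description in \<open>tv_aut\<close>: the substitution is an automorphism with the
prescribed values on \<open>x\<close> and \<open>y\<close>, and these values determine an \<open>R\<close>-endomorphism.\<close>

lemma tv_aut_eq_tv_hom:
  fixes f :: "('k::finite, 'l::finite) B_ring"
  assumes f: "f \<in> tv_series a b"
  shows "tv_aut a b f = tv_hom a b f"
  unfolding tv_aut_def
proof (rule the_equality)
  obtain g where g: "g \<in> tv_series a b" "f * g = 1"
    using tv_series_inverse[OF f] .
  have "bij (tv_hom a b f)"
    using tv_hom_inverse[OF f g] tv_hom_inverse[OF g(1) f] g(2)
    by (intro o_bij[of "tv_hom a b g"]) (auto simp: mult.commute)
  moreover have xy: "tv_hom a b f x_var = x_var * f powi (- b)" "tv_hom a b f y_var = y_var * f powi a"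
    using tv_hom_monomial[of a b f "(1, 0)"] tv_hom_monomial[of a b f "(0, 1)"]
    by (simp_all add: monomial_def x_var_def y_var_def)
  ultimately show "tv_hom a b f \<in> R_automorphisms \<and>
      tv_hom a b f x_var = x_var * f powi (- b) \<and> tv_hom a b f y_var = y_var * f powi a"
    using R_endomorphism_tv_hom[OF f] by (simp add: R_automorphisms_iff)
  fix \<phi> :: "('k, 'l) B_ring \<Rightarrow> ('k, 'l) B_ring"
  assume "\<phi> \<in> R_automorphisms \<and> \<phi> x_var = x_var * f powi (- b) \<and> \<phi> y_var = y_var * f powi a"
  then show "\<phi> = tv_hom a b f"
    using R_endomorphism_tv_hom[OF f] xy by (intro R_endomorphism_eqI) (auto simp: R_automorphisms_iff)
qed

lemma tv_aut_generators:
  fixes f :: "('k::finite, 'l::finite) B_ring"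
  assumes "f \<in> tv_series a b"
  shows "tv_aut a b f x_var = x_var * f powi (- b)"
    and "tv_aut a b f y_var = y_var * f powi a"
  using tv_hom_monomial[of a b f "(1, 0)"] tv_hom_monomial[of a b f "(0, 1)"]
  by (simp_all add: monomial_def x_var_def y_var_def tv_aut_eq_tv_hom[OF assms])

lemma R_endomorphism_tv_aut:
  fixes f :: "('k::finite, 'l::finite) B_ring"
  shows "f \<in> tv_series a b \<Longrightarrow> R_endomorphism (tv_aut a b f)"
  by (simp add: tv_aut_eq_tv_hom R_endomorphism_tv_hom)

lemma tv_aut_supported:
  fixes f :: "('k::finite, 'l::finite) B_ring"
  assumes f: "f \<in> tv_series a b" and F: "F \<in> supported S"
    and T: "\<And>s r. s \<in> S \<Longrightarrow> r \<in> ray a b \<Longrightarrow> s + r \<in> T"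
  shows "tv_aut a b f F - F \<in> supported T"
  using tv_hom_supported[OF assms] by (simp add: tv_aut_eq_tv_hom[OF f])

lemma tv_aut_left_inverse:
  fixes f :: "('k::finite, 'l::finite) B_ring"
  assumes "f \<in> tv_series a b"
  obtains g where "g \<in> tv_series a b" "tv_aut a b g \<circ> tv_aut a b f = id"
proof -
  obtain g where g: "g \<in> tv_series a b" "f * g = 1"
    using tv_series_inverse[OF assms] .
  then show thesis
    using that[OF g(1)] tv_hom_inverse[OF g(1) assms]
    by (simp add: tv_aut_eq_tv_hom assms mult.commute)
qed

section \<open>The grading with \<open>x\<close> in degree \<open>1\<close> and \<open>y\<close> in degree \<open>-1\<close>\<close>

definition deg_le :: "int \<Rightarrow> ('v, laurent) mps set" where
  "deg_le d = supported {u. fst u - snd u \<le> d}"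

definition deg_ge :: "int \<Rightarrow> ('v, laurent) mps set" where
  "deg_ge d = supported {u. d \<le> fst u - snd u}"

text \<open>Unipotence with respect to the grading. The automorphism for \<open>(a, b)\<close> adds multiples of \<open>(a, b)\<close>,
which has degree \<open>a - b\<close>, to the exponents; slopes above one give \<open>lowering\<close> maps and slopes below
one \<open>raising\<close> maps.\<close>

definition lowering :: "(('k, 'l) B_ring \<Rightarrow> ('k, 'l) B_ring) \<Rightarrow> bool" where
  "lowering \<phi> \<longleftrightarrow> (\<forall>d. \<forall>F\<in>deg_le d. \<phi> F - F \<in> deg_le (d - 1))"

definition raising :: "(('k, 'l) B_ring \<Rightarrow> ('k, 'l) B_ring) \<Rightarrow> bool" where
  "raising \<phi> \<longleftrightarrow> (\<forall>d. \<forall>F\<in>deg_ge d. \<phi> F - F \<in> deg_ge (d + 1))"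

lemma deg_le_mono: "F \<in> deg_le d \<Longrightarrow> d \<le> d' \<Longrightarrow> F \<in> deg_le d'"
  unfolding deg_le_def by (erule supported_mono) auto

lemma deg_ge_mono: "F \<in> deg_ge d \<Longrightarrow> d' \<le> d \<Longrightarrow> F \<in> deg_ge d'"
  unfolding deg_ge_def by (erule supported_mono) auto

lemma deg_le_add: "F \<in> deg_le d \<Longrightarrow> G \<in> deg_le d \<Longrightarrow> F + G \<in> deg_le d"
  and deg_le_diff: "F \<in> deg_le d \<Longrightarrow> G \<in> deg_le d \<Longrightarrow> F - G \<in> deg_le d"
  and deg_ge_add: "F \<in> deg_ge d \<Longrightarrow> G \<in> deg_ge d \<Longrightarrow> F + G \<in> deg_ge d"
  and deg_ge_diff: "F \<in> deg_ge d \<Longrightarrow> G \<in> deg_ge d \<Longrightarrow> F - G \<in> deg_ge d"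
  unfolding deg_le_def deg_ge_def by (rule supported_add supported_diff; assumption)+

lemma deg_le_mult: "F \<in> deg_le d \<Longrightarrow> G \<in> deg_le e \<Longrightarrow> F * G \<in> deg_le (d + e)"
  unfolding deg_le_def by (erule (1) supported_mult) auto

lemma deg_ge_mult: "F \<in> deg_ge d \<Longrightarrow> G \<in> deg_ge e \<Longrightarrow> F * G \<in> deg_ge (d + e)"
  unfolding deg_ge_def by (erule (1) supported_mult) auto

lemma deg_disjoint:
  assumes "F \<in> deg_le d" "G \<in> deg_ge e" "d < e" "F - G \<in> order_ideal N"
  shows "F \<in> order_ideal N" "G \<in> order_ideal N"
proof -
  have "- G \<in> supported {u. e \<le> fst u - snd u}"
    using assms(2) by (simp add: deg_ge_def supported_minus)
  then show "F \<in> order_ideal N"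
    using assms by (intro supported_disjoint[of F _ "- G"]) (auto simp: deg_le_def)
  from order_ideal_diff[OF this assms(4)] show "G \<in> order_ideal N"
    by simp
qed

lemma lowering_id: "lowering id"
  and raising_id: "raising id"
  by (simp_all add: lowering_def raising_def deg_le_def deg_ge_def)

lemma lowering_comp:
  assumes "lowering \<phi>" "lowering \<psi>"
  shows "lowering (\<phi> \<circ> \<psi>)"
  unfolding lowering_def
proof (intro allI ballI)
  fix d and F :: "('a, 'b) B_ring"
  assume F: "F \<in> deg_le d"
  then have \<psi>: "\<psi> F - F \<in> deg_le (d - 1)"
    using assms(2) by (simp add: lowering_def)
  then have "\<psi> F \<in> deg_le d"
    using deg_le_add[OF F deg_le_mono[OF \<psi>, of d]] by simp
  then have "\<phi> (\<psi> F) - \<psi> F \<in> deg_le (d - 1)"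
    using assms(1) by (simp add: lowering_def)
  from deg_le_add[OF this \<psi>] show "(\<phi> \<circ> \<psi>) F - F \<in> deg_le (d - 1)"
    by simp
qed

lemma raising_comp:
  assumes "raising \<phi>" "raising \<psi>"
  shows "raising (\<phi> \<circ> \<psi>)"
  unfolding raising_def
proof (intro allI ballI)
  fix d and F :: "('a, 'b) B_ring"
  assume F: "F \<in> deg_ge d"
  then have \<psi>: "\<psi> F - F \<in> deg_ge (d + 1)"
    using assms(2) by (simp add: raising_def)
  then have "\<psi> F \<in> deg_ge d"
    using deg_ge_add[OF F deg_ge_mono[OF \<psi>, of d]] by simp
  then have "\<phi> (\<psi> F) - \<psi> F \<in> deg_ge (d + 1)"
    using assms(1) by (simp add: raising_def)
  from deg_ge_add[OF this \<psi>] show "(\<phi> \<circ> \<psi>) F - F \<in> deg_ge (d + 1)"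
    by simp
qed

lemma lowering_tv_aut:
  fixes f :: "('k::finite, 'l::finite) B_ring"
  assumes "f \<in> tv_series a b" "a < b"
  shows "lowering (tv_aut a b f)"
proof -
  have ray: "fst r - snd r \<le> -1" if r: "r \<in> ray a b" for r
  proof -
    obtain i where "i \<ge> 1" and i: "r = (int i * a, int i * b)"
      using r unfolding ray_def by blast
    have lt: "int i * a < int i * b"
      using assms(2) \<open>i \<ge> 1\<close> by (intro mult_strict_left_mono) simp_all
    show ?thesis
      unfolding i fst_conv snd_conv using lt by linarith
  qed
  show ?thesis
    unfolding lowering_def
  proof (intro allI ballI)
    fix d and F :: "('k, 'l) B_ring"
    assume "F \<in> deg_le d"
    then show "tv_aut a b f F - F \<in> deg_le (d - 1)"
      unfolding deg_le_def
    proof (rule tv_aut_supported[OF assms(1)])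
      fix s r
      assume "s \<in> {u. fst u - snd u \<le> d}" "r \<in> ray a b"
      then show "s + r \<in> {u. fst u - snd u \<le> d - 1}"
        using ray[of r] by simp
    qed
  qed
qed

lemma raising_tv_aut:
  fixes f :: "('k::finite, 'l::finite) B_ring"
  assumes "f \<in> tv_series a b" "b < a"
  shows "raising (tv_aut a b f)"
proof -
  have ray: "1 \<le> fst r - snd r" if r: "r \<in> ray a b" for r
  proof -
    obtain i where "i \<ge> 1" and i: "r = (int i * a, int i * b)"
      using r unfolding ray_def by blast
    have lt: "int i * b < int i * a"
      using assms(2) \<open>i \<ge> 1\<close> by (intro mult_strict_left_mono) simp_all
    show ?thesis
      unfolding i fst_conv snd_conv using lt by linarith
  qed
  show ?thesis
    unfolding raising_def
  proof (intro allI ballI)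
    fix d and F :: "('k, 'l) B_ring"
    assume "F \<in> deg_ge d"
    then show "tv_aut a b f F - F \<in> deg_ge (d + 1)"
      unfolding deg_ge_def
    proof (rule tv_aut_supported[OF assms(1)])
      fix s r
      assume "s \<in> {u. d \<le> fst u - snd u}" "r \<in> ray a b"
      then show "s + r \<in> {u. d + 1 \<le> fst u - snd u}"
        using ray[of r] by simp
    qed
  qed
qed

lemma tv_aut_diagonal_deg_ge:
  fixes f :: "('k::finite, 'l::finite) B_ring"
  assumes f: "f \<in> tv_series 1 1" and F: "F \<in> deg_ge d"
  shows "tv_aut 1 1 f F \<in> deg_ge d"
proof -
  have "tv_aut 1 1 f F - F \<in> deg_ge d"
    using F unfolding deg_ge_def by (rule tv_aut_supported[OF f]) (auto simp: ray_def)
  from deg_ge_add[OF this F] show ?thesis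
    by simp
qed

section \<open>Splitting an ordered product at slope one\<close>

lemma finite_ordered_product_Nil [simp]: "finite_ordered_product f [] = id"
  and finite_ordered_product_Cons [simp]:
    "finite_ordered_product f (p # ps) =
      tv_aut (int (fst p)) (int (snd p)) (f p) \<circ> finite_ordered_product f ps"
  by (simp_all add: finite_ordered_product_def)

lemma finite_ordered_product_append:
  "finite_ordered_product f (ps @ qs) = finite_ordered_product f ps \<circ> finite_ordered_product f qs"
  by (induction ps) (simp_all add: comp_assoc)

text \<open>The left inverse moves the part with slopes above one to the other side of the factorization. It is
built from the automorphisms of the inverse series, which makes it visibly lowering.\<close>

lemma finite_ordered_product_lowering_inverse:
  fixes f :: "nat \<times> nat \<Rightarrow> ('k::finite, 'l::finite) B_ring"
  assumes "\<And>p. p \<in> set ps \<Longrightarrow> f p \<in> tv_series (int (fst p)) (int (snd p)) \<and> fst p < snd p"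
  obtains \<psi> where "R_endomorphism \<psi>" "lowering \<psi>" "\<psi> \<circ> finite_ordered_product f ps = id"
proof -
  have "\<exists>\<psi>. R_endomorphism \<psi> \<and> lowering \<psi> \<and> \<psi> \<circ> finite_ordered_product f ps = id"
    using assms
  proof (induction ps)
    case Nil
    then show ?case
      by (intro exI[of _ id] conjI R_endomorphism_id lowering_id) simp
  next
    case (Cons p ps)
    have "\<exists>\<psi>. R_endomorphism \<psi> \<and> lowering \<psi> \<and> \<psi> \<circ> finite_ordered_product f ps = id"
      by (rule Cons.IH) (simp add: Cons.prems)
    then obtain \<psi> where \<psi>: "R_endomorphism \<psi>" "lowering \<psi>" "\<psi> \<circ> finite_ordered_product f ps = id"
      by blast
    let ?a = "int (fst p)" and ?b = "int (snd p)"
    obtain g where g: "g \<in> tv_series ?a ?b" "tv_aut ?a ?b g \<circ> tv_aut ?a ?b (f p) = id"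
      using tv_aut_left_inverse[of "f p" ?a ?b] Cons.prems by auto
    have "(\<psi> \<circ> tv_aut ?a ?b g) \<circ> finite_ordered_product f (p # ps) =
        \<psi> \<circ> (tv_aut ?a ?b g \<circ> tv_aut ?a ?b (f p)) \<circ> finite_ordered_product f ps"
      by (simp only: comp_assoc finite_ordered_product_Cons)
    then have "(\<psi> \<circ> tv_aut ?a ?b g) \<circ> finite_ordered_product f (p # ps) = id"
      by (simp only: g \<psi> comp_id)
    moreover have "lowering (\<psi> \<circ> tv_aut ?a ?b g)"
      using Cons.prems by (intro lowering_comp \<psi> lowering_tv_aut g) simp
    moreover have "R_endomorphism (\<psi> \<circ> tv_aut ?a ?b g)"
      by (intro R_endomorphism_comp \<psi> R_endomorphism_tv_aut g)
    ultimately show ?case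
      by blast
  qed
  then show thesis
    using that by blast
qed

lemma raising_finite_ordered_product:
  fixes f :: "nat \<times> nat \<Rightarrow> ('k::finite, 'l::finite) B_ring"
  assumes "\<And>p. p \<in> set ps \<Longrightarrow> f p \<in> tv_series (int (fst p)) (int (snd p)) \<and> snd p < fst p"
  shows "raising (finite_ordered_product f ps)"
  using assms
  by (induction ps) (auto intro!: raising_id raising_comp raising_tv_aut)

text \<open>The function \<open>a / (a + b)\<close> increases as the slope \<open>b / a\<close> decreases, is also defined for the infinite
slope of \<open>(0, 1)\<close>, and separates coprime pairs.\<close>

lemma exists_sorted_by_slope:
  fixes S :: "(nat \<times> nat) set"
  assumes "finite S" "S \<subseteq> {(a, b). coprime a b}"
  obtains ps where "set ps = S" "sorted_wrt slope_greater ps"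
proof -
  define key :: "nat \<times> nat \<Rightarrow> real" where "key p = real (fst p) / real (fst p + snd p)" for p
  have rpos: "real (fst p + snd p) > 0" if "p \<in> S" for p
    using that assms(2) unfolding of_nat_0_less_iff by (cases p) (auto intro: gr0I)
  have less: "slope_greater p q" if "p \<in> S" "q \<in> S" "key p < key q" for p q
  proof -
    have "real (fst p) * real (fst q + snd q) < real (fst q) * real (fst p + snd p)"
      using that(3) rpos[OF that(1)] rpos[OF that(2)] unfolding key_def
      by (simp add: field_simps del: of_nat_add)
    then have "fst p * snd q < fst q * snd p"
      unfolding of_nat_mult[symmetric] of_nat_less_iff by (simp add: algebra_simps)
    then show ?thesis
      by (simp add: slope_greater_def case_prod_unfold mult.commute)
  qed
  have inj: "inj_on key S"
  proof (rule inj_onI)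
    fix p q
    assume pq: "p \<in> S" "q \<in> S" "key p = key q"
    then have "real (fst p) * real (fst q + snd q) = real (fst q) * real (fst p + snd p)"
      using rpos[OF pq(1)] rpos[OF pq(2)] pq(3) unfolding key_def
      by (simp add: field_simps del: of_nat_add)
    then have "fst p * snd q = fst q * snd p"
      unfolding of_nat_mult[symmetric] of_nat_eq_iff by (simp add: algebra_simps)
    moreover have "coprime (fst p) (snd p)" "coprime (fst q) (snd q)"
      using pq assms(2) by auto
    ultimately show "p = q"
      using coprime_crossproduct_nat[of "fst p" "snd p" "fst q" "snd q"]
      by (auto simp: prod_eq_iff)
  qed
  let ?ks = "sorted_list_of_set (key ` S)"
  have "sorted_wrt slope_greater (map (inv_into S key) ?ks)"
    unfolding sorted_wrt_map
  proof (rule sorted_wrt_mono_rel[OF _ strict_sorted_list_of_set])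
    fix x y
    assume "x \<in> set ?ks" "y \<in> set ?ks" "x < y"
    then have "x \<in> key ` S" "y \<in> key ` S"
      using assms(1) by auto
    then show "slope_greater (inv_into S key x) (inv_into S key y)"
      using \<open>x < y\<close> by (intro less) (auto simp: inv_into_into f_inv_into_f)
  qed
  moreover have "set (map (inv_into S key) ?ks) = S"
    using assms(1) inj by (simp add: image_image)
  ultimately show thesis
    using that by blast
qed

lemma madic_ideal_subset_order_ideal: "madic_ideal N \<subseteq> (order_ideal N :: ('k::finite, 'l::finite) B_ring set)"
proof -
  interpret B: module "times :: ('k, 'l) B_ring \<Rightarrow> ('k, 'l) B_ring \<Rightarrow> ('k, 'l) B_ring"
    by unfold_locales (simp_all add: algebra_simps)
  have prod: "of_R (prod_list rs) \<in> (order_ideal (length rs) :: ('k, 'l) B_ring set)"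
    if "set rs \<subseteq> max_ideal" for rs :: "('k, 'l) R_ring list"
  proof -
    have "prod_list rs \<in> order_ideal (length rs)"
      using that
    proof (induction rs)
      case (Cons r rs)
      then have "r \<in> order_ideal 1"
        unfolding order_ideal_1_iff by (simp add: max_ideal_def)
      from order_ideal_mult[OF this, of "prod_list rs" "length rs"] Cons show ?case
        by simp
    qed simp
    then show ?thesis
      by (simp add: order_ideal_def of_R_def)
  qed
  have "B.subspace (order_ideal N)"
    by (auto simp: B.subspace_def intro: order_ideal_add order_ideal_mult_left)
  then show ?thesis
    unfolding madic_ideal_def using prod by (intro B.span_minimal) auto
qed

text \<open>The factorization problem expressed by the images of \<open>x\<close> and \<open>y\<close>. For a factorization
\<open>\<theta> = L \<circ> D \<circ> U\<close> into a lowering map, the map for slope one and a raising map, the unknowns are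
\<open>A = L\<^sup>-\<^sup>1 x\<close>, \<open>Y = L\<^sup>-\<^sup>1 y\<close>, \<open>X = D (U x)\<close> and \<open>B = D (U y)\<close>. The lowest-degree part of \<open>B\<close> is
\<open>y f\<close>, so that \<open>f\<close> can be recovered from a solution.\<close>

definition birkhoff_mod :: "nat \<Rightarrow> ('k::finite, 'l::finite) B_ring \<Rightarrow> ('k, 'l) B_ring \<Rightarrow> ('k, 'l) B_ring \<Rightarrow>
    ('k, 'l) B_ring \<Rightarrow> ('k, 'l) B_ring \<Rightarrow> bool" where
  "birkhoff_mod N f A B X Y \<longleftrightarrow>
     A - x_var \<in> deg_le 0 \<and> X \<in> deg_ge 1 \<and> A - X * (\<Prod>l\<in>UNIV. 1 + t_var l * B) \<in> order_ideal N \<and>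
     B - y_var * f \<in> deg_ge 0 \<and> Y - y_var \<in> deg_le (- 2) \<and>
     B - Y * (\<Prod>k\<in>UNIV. 1 + s_var k * A) \<in> order_ideal N"

lemma x_var_eq_monomial: "x_var = monomial (1, 0)"
  and y_var_eq_monomial: "y_var = monomial (0, 1)"
  by (simp_all add: x_var_def y_var_def monomial_def)

lemma deg_x_var: "x_var \<in> deg_le 1" "x_var \<in> deg_ge 1"
  and deg_y_var: "y_var \<in> deg_le (- 1)" "y_var \<in> deg_ge (- 1)"
  unfolding x_var_eq_monomial y_var_eq_monomial deg_le_def deg_ge_def
  by (simp_all add: supported_monomial)

lemma s_var_in_order_ideal: "s_var k \<in> order_ideal 1"
  and t_var_in_order_ideal: "t_var l \<in> order_ideal 1"
  by (simp_all only: s_var_def t_var_def mps_var_in_order_ideal)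

lemma prod_one_plus_in_tv_series:
  fixes g :: "'i \<Rightarrow> ('k::finite, 'l::finite) B_ring"
  assumes "\<And>i. g i \<in> supported (ray a b)" "\<And>i. g i \<in> order_ideal 1"
  shows "(\<Prod>i\<in>A. 1 + g i) \<in> tv_series a b"
proof -
  have "(\<Prod>i\<in>A. 1 + g i) - 1 \<in> supported (ray a b)"
    by (rule one_plus_supported_prod[OF ray_add]) (simp_all add: assms)
  moreover have "(\<Prod>i\<in>A. 1 + g i) - 1 \<in> order_ideal 1"
    using order_ideal_diff_prod[of A "\<lambda>i. 1 + g i" "\<lambda>_. 1" 1] assms by simp
  ultimately show ?thesis
    by (simp add: tv_series_iff)
qed

lemma s_product_in_tv_series:
  "(\<Prod>k\<in>UNIV. 1 + s_var k * x_var) \<in> (tv_series 1 0 :: ('k::finite, 'l::finite) B_ring set)"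
proof (rule prod_one_plus_in_tv_series)
  fix k
  show "s_var k * x_var \<in> (supported (ray 1 0) :: ('k, 'l) B_ring set)"
    unfolding s_var_def x_var_eq_monomial
    by (rule supported_mult[OF supported_mps_var[of "{0}"] supported_monomial[of _ "{(1, 0)}"]])
      (auto simp: ray_def intro!: exI[of _ 1])
  show "s_var k * x_var \<in> (order_ideal 1 :: ('k, 'l) B_ring set)"
    by (rule order_ideal_mult_right[OF s_var_in_order_ideal])
qed

lemma t_product_in_tv_series:
  "(\<Prod>l\<in>UNIV. 1 + t_var l * y_var) \<in> (tv_series 0 1 :: ('k::finite, 'l::finite) B_ring set)"
proof (rule prod_one_plus_in_tv_series)
  fix l
  show "t_var l * y_var \<in> (supported (ray 0 1) :: ('k, 'l) B_ring set)"
    unfolding t_var_def y_var_eq_monomial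
    by (rule supported_mult[OF supported_mps_var[of "{0}"] supported_monomial[of _ "{(0, 1)}"]])
      (auto simp: ray_def intro!: exI[of _ 1])
  show "t_var l * y_var \<in> (order_ideal 1 :: ('k, 'l) B_ring set)"
    by (rule order_ideal_mult_right[OF t_var_in_order_ideal])
qed

lemma endo_s_t_product:
  fixes \<phi> :: "('k::finite, 'l::finite) B_ring \<Rightarrow> ('k, 'l) B_ring"
  assumes "R_endomorphism \<phi>"
  shows "\<phi> (\<Prod>k\<in>A. 1 + s_var k * F) = (\<Prod>k\<in>A. 1 + s_var k * \<phi> F)"
    and "\<phi> (\<Prod>l\<in>A'. 1 + t_var l * F) = (\<Prod>l\<in>A'. 1 + t_var l * \<phi> F)"
  by (simp_all add: endo_prod[OF assms] endo_add[OF assms] endo_one[OF assms] endo_mult[OF assms]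
      endo_mps_var[OF assms] s_var_def t_var_def)

text \<open>The two congruences are \<open>\<theta> x * (\<Prod>l. 1 + t\<^sub>l * \<theta> y) = x\<close> and \<open>\<theta> y = y * (\<Prod>k. 1 + s\<^sub>k * x)\<close> after
application of \<open>L\<^sup>-\<^sup>1\<close>, because \<open>L\<^sup>-\<^sup>1 \<circ> \<theta>\<close> agrees with \<open>D \<circ> U\<close> modulo the \<open>N\<close>-th power of the
maximal ideal.\<close>

lemma ordered_factorization_imp_birkhoff_mod:
  fixes f :: "nat \<times> nat \<Rightarrow> ('k::finite, 'l::finite) B_ring"
  assumes fact: "ordered_factorization
     (tv_aut 1 0 (\<Prod>k\<in>UNIV. 1 + s_var k * x_var) \<circ> tv_aut 0 1 (\<Prod>l\<in>UNIV. 1 + t_var l * y_var)) f"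
  obtains A B X Y where "birkhoff_mod N (f (1, 1)) A B X Y"
proof -
  let ?F = "(\<Prod>k\<in>UNIV. 1 + s_var k * x_var) :: ('k, 'l) B_ring"
  let ?G = "(\<Prod>l\<in>UNIV. 1 + t_var l * y_var) :: ('k, 'l) B_ring"
  define \<theta> where "\<theta> = tv_aut 1 0 ?F \<circ> tv_aut 0 1 ?G"
  note F = s_product_in_tv_series[where 'k = 'k and 'l = 'l]
  note G = t_product_in_tv_series[where 'k = 'k and 'l = 'l]
  have f: "f p \<in> tv_series (int (fst p)) (int (snd p))" if "coprime (fst p) (snd p)" for p
    using fact that unfolding ordered_factorization_def by (metis prod.collapse)
  obtain S where S: "finite S" "S \<subseteq> {(a, b). coprime a b}"
    and cong: "\<And>ps. S \<subseteq> set ps \<and> set ps \<subseteq> {(a, b). coprime a b} \<and> sorted_wrt slope_greater ps \<Longrightarrow>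
       madic_cong N (finite_ordered_product f ps) \<theta>"
    using fact unfolding ordered_factorization_def \<theta>_def by metis
  obtain ps where ps: "set ps = insert (1, 1) S" "sorted_wrt slope_greater ps"
    using exists_sorted_by_slope[of "insert (1, 1) S"] S by auto
  have coprime: "coprime (fst p) (snd p)" if "p \<in> set ps" for p
    using that ps S(2) by auto
  obtain ps1 ps2 where split: "ps = ps1 @ (1, 1) # ps2"
    using ps(1) by (metis insertI1 split_list)
  have ps1: "fst p < snd p" if "p \<in> set ps1" for p
    using ps(2) that by (auto simp: split sorted_wrt_append slope_greater_def)
  have ps2: "snd p < fst p" if "p \<in> set ps2" for p
    using ps(2) that by (auto simp: split sorted_wrt_append slope_greater_def)
  obtain \<psi> where \<psi>: "R_endomorphism \<psi>" "lowering \<psi>" "\<psi> \<circ> finite_ordered_product f ps1 = id"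
    using finite_ordered_product_lowering_inverse[of ps1 f] f coprime ps1 by (auto simp: split)
  define D where "D = tv_aut 1 1 (f (1, 1))"
  define U where "U = finite_ordered_product f ps2"
  have U: "raising U"
    unfolding U_def using f coprime ps2 by (intro raising_finite_ordered_product) (auto simp: split)
  have f11: "f (1, 1) \<in> tv_series 1 1"
    using f[of "(1, 1)"] by simp
  have D: "R_endomorphism D"
    unfolding D_def by (rule R_endomorphism_tv_aut[OF f11])
  have "\<psi> \<circ> finite_ordered_product f ps = (\<psi> \<circ> finite_ordered_product f ps1) \<circ> (D \<circ> U)"
    by (simp add: split finite_ordered_product_append comp_assoc D_def U_def)
  then have DU: "\<psi> (finite_ordered_product f ps H) = D (U H)" for H
    using \<psi>(3) by (metis comp_apply id_comp)
  have cong': "D (U H) - \<psi> (\<theta> H) \<in> order_ideal N" for H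
  proof -
    have "madic_cong N (finite_ordered_product f ps) \<theta>"
      using ps S(2) by (intro cong) auto
    then have "finite_ordered_product f ps H - \<theta> H \<in> order_ideal N"
      unfolding madic_cong_def using madic_ideal_subset_order_ideal by blast
    from endo_order_ideal[OF \<psi>(1) this] show ?thesis
      by (simp add: endo_diff[OF \<psi>(1)] DU)
  qed
  note T10 = R_endomorphism_tv_aut[OF F]
  have \<theta>y: "\<theta> y_var = y_var * ?F"
    by (simp add: \<theta>_def tv_aut_generators[OF G] tv_aut_generators[OF F])
  have \<theta>x: "\<theta> x_var * (\<Prod>l\<in>UNIV. 1 + t_var l * \<theta> y_var) = x_var"
  proof -
    obtain G' where G': "?G * G' = 1"
      using tv_series_inverse[OF G] by blast
    have "\<theta> x_var * (\<Prod>l\<in>UNIV. 1 + t_var l * \<theta> y_var) = tv_aut 1 0 ?F (x_var * (?G powi (- 1) * ?G))"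
      by (simp add: \<theta>_def tv_aut_generators[OF G] endo_mult[OF T10] endo_s_t_product[OF T10] mult.assoc)
    also have "?G powi (- 1) * ?G = 1"
      using power_int_unit_minus[OF G', of 1] by (simp add: mult.commute)
    finally show ?thesis
      by (simp add: tv_aut_generators[OF F])
  qed
  define A where "A = \<psi> x_var"
  define Y where "Y = \<psi> y_var"
  define X where "X = D (U x_var)"
  define B where "B = D (U y_var)"
  have A: "\<psi> (\<theta> x_var) * (\<Prod>l\<in>UNIV. 1 + t_var l * \<psi> (\<theta> y_var)) = A"
    using arg_cong[OF \<theta>x, of \<psi>]
    by (simp add: endo_mult[OF \<psi>(1)] endo_s_t_product[OF \<psi>(1)] A_def)
  have Y: "\<psi> (\<theta> y_var) = Y * (\<Prod>k\<in>UNIV. 1 + s_var k * A)"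
    by (simp add: \<theta>y endo_mult[OF \<psi>(1)] endo_s_t_product[OF \<psi>(1)] A_def Y_def)
  have "A - x_var \<in> deg_le 0"
    using \<psi>(2) deg_x_var(1) unfolding lowering_def A_def by fastforce
  moreover have "Y - y_var \<in> deg_le (- 2)"
    using \<psi>(2) deg_y_var(1) unfolding lowering_def Y_def by fastforce
  moreover have "X \<in> deg_ge 1"
  proof -
    have "U x_var - x_var \<in> deg_ge 2"
      using U deg_x_var(2) unfolding raising_def by fastforce
    then have "U x_var \<in> deg_ge 1"
      using deg_ge_add[OF deg_x_var(2) deg_ge_mono[of _ 2 1]] by fastforce
    then show ?thesis
      unfolding X_def D_def by (rule tv_aut_diagonal_deg_ge[OF f11])
  qed
  moreover have "B - y_var * f (1, 1) \<in> deg_ge 0"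
  proof -
    have "U y_var - y_var \<in> deg_ge 0"
      using U deg_y_var(2) unfolding raising_def by fastforce
    then have "D (U y_var - y_var) \<in> deg_ge 0"
      unfolding D_def by (rule tv_aut_diagonal_deg_ge[OF f11])
    moreover have "D y_var = y_var * f (1, 1)"
      using tv_aut_generators(2)[OF f11] by (simp add: D_def)
    ultimately show ?thesis
      by (simp add: B_def endo_diff[OF D])
  qed
  moreover have "A - X * (\<Prod>l\<in>UNIV. 1 + t_var l * B) \<in> order_ideal N"
  proof -
    have "(\<Prod>l\<in>UNIV. 1 + t_var l * B) - (\<Prod>l\<in>UNIV. 1 + t_var l * \<psi> (\<theta> y_var)) \<in> order_ideal N"
      using cong'[of y_var]
      by (intro order_ideal_diff_prod) (simp add: B_def order_ideal_mult_left flip: right_diff_distrib)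
    from order_ideal_diff_mult[OF cong'[of x_var] this] show ?thesis
      unfolding A X_def[symmetric] by (rule order_ideal_diff_sym)
  qed
  moreover have "B - Y * (\<Prod>k\<in>UNIV. 1 + s_var k * A) \<in> order_ideal N"
    using cong'[of y_var] by (simp add: B_def flip: Y)
  ultimately show thesis
    using that unfolding birkhoff_mod_def by blast
qed

section \<open>Uniqueness for the Birkhoff problem\<close>

text \<open>Read \<open>X\<close> as \<open>A / G\<close>. Since \<open>G\<close> is \<open>1\<close> modulo the ideal and agrees with \<open>G'\<close> to one order more than
is known for \<open>A\<close> and \<open>A'\<close>, dividing by it does not affect the leading term of \<open>A - A'\<close>.\<close>

lemma quotient_difference_step:
  fixes A A' X X' G G' :: "('v::finite, laurent) mps"
  assumes A: "A - X * G \<in> order_ideal (Suc M)" "A' - X' * G' \<in> order_ideal (Suc M)"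
    and G: "G - G' \<in> order_ideal (Suc M)" "G - 1 \<in> order_ideal 1"
    and AA': "A - A' \<in> order_ideal M"
  shows "(A - A') - (X - X') \<in> order_ideal (Suc M)"
proof -
  obtain H where H: "G * H = 1"
    using one_plus_inverse[of UNIV G] G(2) by auto
  have "(A - A') - (X - X') * G = (A - X * G) - (A' - X' * G') + X' * (G - G')"
    by (simp add: algebra_simps)
  then have 1: "(A - A') - (X - X') * G \<in> order_ideal (Suc M)"
    using order_ideal_add[OF order_ideal_diff[OF A] order_ideal_mult_left[OF G(1)]]
    by (simp only:)
  have "(A - A') - ((A - A') - (X - X') * G) \<in> order_ideal M"
    using order_ideal_diff[OF AA' order_ideal_mono[OF 1]] by simp
  then have "(X - X') * G * H \<in> order_ideal M"
    by (intro order_ideal_mult_right[of "(X - X') * G"]) simp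
  then have "X - X' \<in> order_ideal M"
    by (simp add: H mult.assoc)
  then have "(G - 1) * (X - X') \<in> order_ideal (Suc M)"
    using order_ideal_mult[OF G(2)] by fastforce
  from order_ideal_add[OF 1 this] show ?thesis
    by (simp add: algebra_simps)
qed

text \<open>Suppose that two solutions agree modulo \<open>order_ideal M\<close>. The products then agree to one order more,
so \<open>A - A'\<close> and \<open>X - X'\<close> agree modulo \<open>order_ideal (Suc M)\<close>. The former has degrees at most \<open>0\<close> as
the terms \<open>x\<close> cancel, the latter has degrees at least \<open>1\<close>, and both must vanish to the next order. In
the same way \<open>B - B'\<close>, of degrees at least \<open>-1\<close>, is compared with \<open>Y - Y'\<close>, of degrees at most \<open>-2\<close>.\<close>

lemma birkhoff_mod_unique:
  fixes f f' :: "('k::finite, 'l::finite) B_ring"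
  assumes sol: "birkhoff_mod N f A B X Y" and sol': "birkhoff_mod N f' A' B' X' Y'"
    and f: "f \<in> deg_le 0" "f \<in> deg_ge 0" and f': "f' \<in> deg_le 0" "f' \<in> deg_ge 0"
  shows "f - f' \<in> order_ideal N"
proof -
  let ?s = "\<lambda>A :: ('k, 'l) B_ring. \<Prod>k\<in>UNIV. 1 + s_var k * A"
  let ?t = "\<lambda>B :: ('k, 'l) B_ring. \<Prod>l\<in>UNIV. 1 + t_var l * B"
  have s: "?s A - ?s A' \<in> order_ideal (Suc M)" if "A - A' \<in> order_ideal M" for A A' M
    using order_ideal_mult[OF s_var_in_order_ideal that]
    by (intro order_ideal_diff_prod) (simp add: right_diff_distrib)
  have t: "?t B - ?t B' \<in> order_ideal (Suc M)" if "B - B' \<in> order_ideal M" for B B' M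
    using order_ideal_mult[OF t_var_in_order_ideal that]
    by (intro order_ideal_diff_prod) (simp add: right_diff_distrib)
  have deg: "(A - x_var) - (A' - x_var) \<in> deg_le 0" "X - X' \<in> deg_ge 1"
      "(Y - y_var) - (Y' - y_var) \<in> deg_le (- 2)"
      "(B - y_var * f) - (B' - y_var * f') \<in> deg_ge 0"
    using sol sol' unfolding birkhoff_mod_def by (blast intro: deg_le_diff deg_ge_diff)+
  have yf: "y_var * f - y_var * f' \<in> deg_ge (- 1)" "y_var * f - y_var * f' \<in> deg_le (- 1)"
    using deg_ge_diff[OF deg_ge_mult[OF deg_y_var(2) f(2)] deg_ge_mult[OF deg_y_var(2) f'(2)]]
      deg_le_diff[OF deg_le_mult[OF deg_y_var(1) f(1)] deg_le_mult[OF deg_y_var(1) f'(1)]]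
    by simp_all
  have degB: "B - B' \<in> deg_ge (- 1)"
    using deg_ge_add[OF yf(1) deg_ge_mono[OF deg(4), of "- 1"]] by simp
  have "M \<le> N \<Longrightarrow> A - A' \<in> order_ideal M \<and> B - B' \<in> order_ideal M" for M
  proof (induction M)
    case (Suc M)
    have "A - X * ?t B \<in> order_ideal (Suc M)" "A' - X' * ?t B' \<in> order_ideal (Suc M)"
      "B - Y * ?s A \<in> order_ideal (Suc M)" "B' - Y' * ?s A' \<in> order_ideal (Suc M)"
      using sol sol' Suc.prems unfolding birkhoff_mod_def by (blast intro: order_ideal_mono)+
    moreover have "?t B - 1 \<in> order_ideal 1" "?s A - 1 \<in> order_ideal 1"
      using t[of B 0 0] s[of A 0 0] by simp_all
    ultimately have step: "(A - A') - (X - X') \<in> order_ideal (Suc M)"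
      "(B - B') - (Y - Y') \<in> order_ideal (Suc M)"
      using Suc s t by (auto intro!: quotient_difference_step)
    have "A - A' \<in> order_ideal (Suc M)"
      using deg_disjoint(1)[OF _ deg(2) _ step(1), of 0] deg(1) by simp
    moreover have "B - B' \<in> order_ideal (Suc M)"
      using deg_disjoint(2)[OF _ degB _ order_ideal_diff_sym[OF step(2)], of "- 2"] deg(3) by simp
    ultimately show ?case
      by simp
  qed simp
  then have "B - B' \<in> order_ideal N"
    by simp
  then have "(y_var * f - y_var * f') - (- ((B - y_var * f) - (B' - y_var * f'))) \<in> order_ideal N"
    by simp
  moreover have "- ((B - y_var * f) - (B' - y_var * f')) \<in> deg_ge 0"
    using deg(4) unfolding deg_ge_def by (rule supported_minus)
  ultimately have "y_var * f - y_var * f' \<in> order_ideal N"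
    using deg_disjoint(1)[OF yf(2)] by fastforce
  then have "monomial (- (0, 1)) * (y_var * f - y_var * f') \<in> order_ideal N"
    by (rule order_ideal_mult_left)
  also have "monomial (- (0, 1)) * (y_var * f - y_var * f') = (monomial (- (0, 1)) * monomial (0, 1)) * (f - f')"
    by (simp only: y_var_eq_monomial right_diff_distrib mult.assoc)
  finally show ?thesis
    by (simp only: monomial_uminus_mult mult_1)
qed

section \<open>The explicit solution\<close>

text \<open>The divided difference \<open>(P w - P u) / (w - u)\<close> of a product \<open>P\<close> of linear factors, split into its
value \<open>q0\<close> at \<open>w = 0\<close> and the rest. The second equation is the case \<open>w = 0\<close>; it links \<open>q0\<close> to \<open>P u\<close>.\<close>

lemma product_divided_difference:
  fixes \<alpha> :: "'i \<Rightarrow> ('v, laurent) mps"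
  assumes S: "0 \<in> S" "\<And>s t. s \<in> S \<Longrightarrow> t \<in> S \<Longrightarrow> s + t \<in> S"
    and w: "w \<in> supported S" and u: "u \<in> supported S" and \<alpha>: "\<And>i. \<alpha> i \<in> supported S"
  obtains q0 q1 where "q0 \<in> supported S" "q1 \<in> supported S"
    and "(\<Prod>i\<in>I. 1 + \<alpha> i * w) - (\<Prod>i\<in>I. 1 + \<alpha> i * u) = (w - u) * (q0 + w * q1)"
    and "1 - (\<Prod>i\<in>I. 1 + \<alpha> i * u) = - u * q0"
proof -
  have mult: "F * G \<in> supported S" if "F \<in> supported S" "G \<in> supported S" for F G :: "('v, laurent) mps"
    using that S(2) by (rule supported_mult)
  have one: "1 \<in> supported S"
    using S(1) by simp
  have "\<exists>q0 q1. q0 \<in> supported S \<and> q1 \<in> supported S \<and>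
      (\<Prod>i\<in>I. 1 + \<alpha> i * w) - (\<Prod>i\<in>I. 1 + \<alpha> i * u) = (w - u) * (q0 + w * q1) \<and>
      1 - (\<Prod>i\<in>I. 1 + \<alpha> i * u) = - u * q0"
  proof (induction I rule: infinite_finite_induct)
    case (insert i I)
    then obtain q0 q1 where q: "q0 \<in> supported S" "q1 \<in> supported S"
      and 1: "(\<Prod>i\<in>I. 1 + \<alpha> i * w) - (\<Prod>i\<in>I. 1 + \<alpha> i * u) = (w - u) * (q0 + w * q1)"
      and 2: "1 - (\<Prod>i\<in>I. 1 + \<alpha> i * u) = - u * q0"
      by blast
    let ?P = "\<lambda>w. \<Prod>i\<in>I. 1 + \<alpha> i * w"
    have Pu: "?P u \<in> supported S"
      by (intro supported_prod[OF S] supported_add one mult \<alpha> u)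
    have "(\<Prod>i\<in>insert i I. 1 + \<alpha> i * w) - (\<Prod>i\<in>insert i I. 1 + \<alpha> i * u) =
        (1 + \<alpha> i * w) * (?P w - ?P u) + \<alpha> i * (w - u) * ?P u"
      using insert.hyps by (simp add: algebra_simps)
    also have "\<dots> = (w - u) * ((q0 + ?P u * \<alpha> i) + w * (q1 + \<alpha> i * (q0 + w * q1)))"
      unfolding 1 by (simp add: algebra_simps)
    finally have *: "(\<Prod>i\<in>insert i I. 1 + \<alpha> i * w) - (\<Prod>i\<in>insert i I. 1 + \<alpha> i * u) = \<dots>" .
    have "1 - (\<Prod>i\<in>insert i I. 1 + \<alpha> i * u) = (1 - ?P u) - \<alpha> i * u * ?P u"
      using insert.hyps by (simp add: algebra_simps)
    also have "\<dots> = - u * (q0 + ?P u * \<alpha> i)"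
      unfolding 2 by (simp add: algebra_simps)
    finally show ?case
      using * q
      by (intro exI[of _ "q0 + ?P u * \<alpha> i"] exI[of _ "q1 + \<alpha> i * (q0 + w * q1)"] conjI supported_add mult Pu \<alpha> w)
  qed (auto intro!: exI[of _ 0])
  then show thesis
    using that by blast
qed

definition diagonal :: "(int \<times> int) set" where
  "diagonal = {u. fst u = snd u}"

lemma supported_diagonal_deg:
  assumes "F \<in> supported diagonal"
  shows "F \<in> deg_le 0" "F \<in> deg_ge 0"
  unfolding deg_le_def deg_ge_def by (rule supported_mono[OF assms], auto simp: diagonal_def)+

lemma diagonal_add: "0 \<in> diagonal" "u \<in> diagonal \<Longrightarrow> w \<in> diagonal \<Longrightarrow> u + w \<in> diagonal"
  by (auto simp: diagonal_def)

lemma supported_diagonal_mult: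
  "F \<in> supported diagonal \<Longrightarrow> G \<in> supported diagonal \<Longrightarrow> F * G \<in> supported diagonal"
  by (erule (1) supported_mult) (rule diagonal_add)

lemma supported_diagonal_vars:
  "s_var k \<in> supported diagonal" "t_var l \<in> supported diagonal" "x_var * y_var \<in> supported diagonal"
proof -
  show "s_var k \<in> supported diagonal" "t_var l \<in> supported diagonal"
    by (simp_all add: s_var_def t_var_def supported_mps_var diagonal_add)
  show "x_var * y_var \<in> supported diagonal"
    unfolding x_var_eq_monomial y_var_eq_monomial monomial_mult
    by (rule supported_monomial) (simp add: diagonal_def)
qed

text \<open>The factor \<open>s\<^sub>k\<close> makes the right-hand side a contraction. That only powers of \<open>x y\<close> occur in the
solution is inherited from the iteration.\<close>

lemma functional_equations_unique_solution:
  obtains R :: "'k::finite \<Rightarrow> 'l::finite \<Rightarrow> ('k, 'l) B_ring"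
  where "\<And>R'. (\<forall>k l. R' k l = 1 + s_var k * t_var l * x_var * y_var *
               (\<Prod>k'\<in>UNIV - {k}. \<Prod>l'\<in>UNIV - {l}. R' k' l')) \<longleftrightarrow> R' = R"
    and "\<And>k l. R k l \<in> supported diagonal"
proof -
  let ?C = "{c :: laurent. Poly_Mapping.keys c \<subseteq> diagonal}"
  define \<Phi> :: "('k \<times> 'l \<Rightarrow> ('k, 'l) B_ring) \<Rightarrow> 'k \<times> 'l \<Rightarrow> ('k, 'l) B_ring" where
    "\<Phi> H i = 1 + s_var (fst i) * t_var (snd i) * x_var * y_var *
       (\<Prod>k'\<in>UNIV - {fst i}. \<Prod>l'\<in>UNIV - {snd i}. H (k', l'))" for H i
  have contr: "\<Phi> F i - \<Phi> G i \<in> order_ideal (Suc N)" if "\<And>j. F j - G j \<in> order_ideal N" for F G N i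
  proof -
    let ?P = "\<lambda>H. \<Prod>k'\<in>UNIV - {fst i}. \<Prod>l'\<in>UNIV - {snd i}. H (k', l')"
    have "?P F - ?P G \<in> order_ideal N"
      by (intro order_ideal_diff_prod that)
    then have "s_var (fst i) * (t_var (snd i) * x_var * y_var * (?P F - ?P G)) \<in> order_ideal (1 + N)"
      by (intro order_ideal_mult s_var_in_order_ideal order_ideal_mult_left)
    then show ?thesis
      by (simp add: \<Phi>_def right_diff_distrib mult.assoc)
  qed
  have closed: "mps_coeff (\<Phi> H i) n \<in> ?C" if "\<And>j m. mps_coeff (H j) m \<in> ?C" for H i n
  proof -
    have H: "H j \<in> supported diagonal" for j
      using that by (simp add: supported_def)
    have "1 + s_var (fst i) * t_var (snd i) * (x_var * y_var) *
       (\<Prod>k'\<in>UNIV - {fst i}. \<Prod>l'\<in>UNIV - {snd i}. H (k', l')) \<in> supported diagonal"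
      by (intro supported_add supported_one supported_diagonal_mult supported_diagonal_vars
          supported_prod diagonal_add H)
    then show ?thesis
      by (simp add: \<Phi>_def supported_def mult.assoc)
  qed
  have "0 \<in> ?C"
    by simp
  obtain F where F: "\<And>G. \<Phi> G = G \<longleftrightarrow> G = F" and F': "\<And>i n. mps_coeff (F i) n \<in> ?C"
    by (rule contraction_fixed_point[of \<Phi>, OF contr \<open>0 \<in> ?C\<close> closed]) auto
  show thesis
  proof
    fix R' :: "'k \<Rightarrow> 'l \<Rightarrow> ('k, 'l) B_ring"
    let ?rhs = "\<lambda>k l. 1 + s_var k * t_var l * x_var * y_var *
               (\<Prod>k'\<in>UNIV - {k}. \<Prod>l'\<in>UNIV - {l}. R' k' l')"
    have \<Phi>: "\<Phi> (case_prod R') (k, l) = ?rhs k l" for k l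
      by (simp add: \<Phi>_def)
    have "(\<forall>k l. R' k l = ?rhs k l) \<longleftrightarrow> (\<forall>k l. \<Phi> (case_prod R') (k, l) = R' k l)"
      unfolding \<Phi> by (intro iff_allI eq_commute)
    also have "\<dots> \<longleftrightarrow> \<Phi> (case_prod R') = case_prod R'"
      unfolding fun_eq_iff split_paired_All prod.case ..
    also have "\<dots> \<longleftrightarrow> case_prod R' = F"
      by (rule F)
    also have "\<dots> \<longleftrightarrow> R' = curry F"
      by (metis curry_case_prod case_prod_curry)
    finally show "(\<forall>k l. R' k l = ?rhs k l) \<longleftrightarrow> R' = curry F" .
  next
    show "curry F k l \<in> supported diagonal" for k l
      using F' by (simp add: supported_def)
  qed
qed

lemma deg_le_unit_inverse:
  fixes F :: "('v::finite, laurent) mps"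
  assumes "F - 1 \<in> deg_le (- 1)" "F - 1 \<in> order_ideal 1"
  shows "\<exists>G. F * G = 1 \<and> G - 1 \<in> deg_le (- 1)"
proof -
  obtain G where "F * G = 1" "G - 1 \<in> supported {u. fst u - snd u \<le> - 1}"
    by (rule one_plus_inverse[of "{u. fst u - snd u \<le> - 1}" F])
      (use assms in \<open>simp_all add: deg_le_def\<close>)
  then show ?thesis
    unfolding deg_le_def by blast
qed

lemma deg_ge_unit_inverse:
  fixes F :: "('v::finite, laurent) mps"
  assumes "F - 1 \<in> deg_ge 0" "F - 1 \<in> order_ideal 1"
  shows "\<exists>G. F * G = 1 \<and> G - 1 \<in> deg_ge 0"
proof -
  obtain G where "F * G = 1" "G - 1 \<in> supported {u. 0 \<le> fst u - snd u}"
    by (rule one_plus_inverse[of "{u. 0 \<le> fst u - snd u}" F])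
      (use assms in \<open>simp_all add: deg_ge_def\<close>)
  then show ?thesis
    unfolding deg_ge_def by blast
qed

text \<open>Let \<open>z = x y\<close> and look for a solution of the form \<open>A = x \<Prod>\<^sub>l(1 + \<beta>\<^sub>l y)\<close>, \<open>B = y f \<Prod>\<^sub>k(1 + \<alpha>\<^sub>k x)\<close> with
\<open>\<alpha>\<^sub>k\<close> and \<open>\<beta>\<^sub>l\<close> of degree \<open>0\<close>. The quotients \<open>X\<close> and \<open>Y\<close> have the right degrees if \<open>1 + s\<^sub>k A\<close> is
\<open>1 + \<alpha>\<^sub>k x\<close> times a series in degrees at most \<open>0\<close>, and \<open>1 + t\<^sub>l B\<close> is \<open>1 + \<beta>\<^sub>l y\<close> times a series in
degrees at least \<open>0\<close>. Divisibility means vanishing at \<open>y = - \<alpha>\<^sub>k z\<close> (where \<open>\<alpha>\<^sub>k x = - 1\<close>) and at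
\<open>x = - \<beta>\<^sub>l z\<close>, that is
\<open>\<alpha>\<^sub>k = s\<^sub>k \<Prod>\<^sub>l(1 - \<alpha>\<^sub>k \<beta>\<^sub>l z)\<close> and \<open>\<beta>\<^sub>l = t\<^sub>l f \<Prod>\<^sub>k(1 - \<alpha>\<^sub>k \<beta>\<^sub>l z)\<close>. For \<open>1 - \<alpha>\<^sub>k \<beta>\<^sub>l z = 1 / R k l\<close> and
\<open>f\<close> the product of all \<open>R k l\<close>, these two systems amount to the functional equations; this \<open>f\<close> is also
the one for which \<open>Y\<close> has leading term \<open>y\<close>.\<close>

lemma functional_equations_birkhoff_mod:
  fixes R :: "'k::finite \<Rightarrow> 'l::finite \<Rightarrow> ('k, 'l) B_ring"
  assumes R: "\<And>k l. R k l = 1 + s_var k * t_var l * x_var * y_var *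
      (\<Prod>k'\<in>UNIV - {k}. \<Prod>l'\<in>UNIV - {l}. R k' l')"
    and diag: "\<And>k l. R k l \<in> supported diagonal"
  obtains A B X Y where "birkhoff_mod N (\<Prod>k\<in>UNIV. \<Prod>l\<in>UNIV. R k l) A B X Y"
proof -
  have "\<exists>q. R k l * q = 1 \<and> q \<in> supported diagonal" for k l
  proof -
    have "R k l - 1 \<in> supported diagonal"
      by (intro supported_diff diag supported_one diagonal_add)
    moreover have "R k l - 1 \<in> order_ideal 1"
      by (subst R, unfold add_diff_cancel_left')
        (intro order_ideal_mult_right s_var_in_order_ideal)
    ultimately obtain q where "R k l * q = 1" "q - 1 \<in> supported diagonal"
      using one_plus_inverse[of diagonal "R k l"] diagonal_add(2) by blast
    then show ?thesis
      using supported_add[of "q - 1" diagonal 1] by (auto simp: diagonal_add)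
  qed
  then obtain r where r: "\<And>k l. R k l * r k l = 1" and r_diag: "\<And>k l. r k l \<in> supported diagonal"
    by metis
  define f where "f = (\<Prod>k\<in>UNIV. \<Prod>l\<in>UNIV. R k l)"
  define z :: "('k, 'l) B_ring" where "z = x_var * y_var"
  define p where "p k = (\<Prod>l\<in>UNIV. r k l)" for k
  define c where "c l = (\<Prod>k\<in>UNIV. r k l)" for l
  define \<alpha> where "\<alpha> k = s_var k * p k" for k
  define \<beta> where "\<beta> l = t_var l * f * c l" for l
  note vars = supported_diagonal_vars
  have f_diag: "f \<in> supported diagonal" and p_diag: "p k \<in> supported diagonal"
    and c_diag: "c l \<in> supported diagonal" for k l
    unfolding f_def p_def c_def by (auto intro!: supported_prod diagonal_add diag r_diag)
  have \<alpha>_diag: "\<alpha> k \<in> supported diagonal" and \<beta>_diag: "\<beta> l \<in> supported diagonal"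
    and z_diag: "z \<in> supported diagonal" for k l
    unfolding \<alpha>_def \<beta>_def z_def by (intro supported_diagonal_mult vars f_diag p_diag c_diag)+
  have fp: "f * (\<Prod>k\<in>UNIV. p k) = 1"
    by (simp add: f_def p_def r flip: prod.distrib)
  \<comment> \<open>In \<open>f * p k * c l\<close> row \<open>k\<close> and column \<open>l\<close> of \<open>R\<close> cancel against \<open>p k\<close> and \<open>c l\<close>, except that the
    entry \<open>(k, l)\<close> occurs once in \<open>f\<close> but twice in \<open>p k * c l\<close>.\<close>
  have \<alpha>\<beta>: "1 - \<alpha> k * \<beta> l * z = r k l" for k l
  proof -
    let ?P = "\<Prod>k'\<in>UNIV - {k}. \<Prod>l'\<in>UNIV - {l}. R k' l'"
    have "f = (\<Prod>l'\<in>UNIV. R k l') * (\<Prod>k'\<in>UNIV - {k}. \<Prod>l'\<in>UNIV. R k' l')"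
      unfolding f_def by (rule prod.remove) auto
    also have "(\<Prod>k'\<in>UNIV - {k}. \<Prod>l'\<in>UNIV. R k' l') = (\<Prod>k'\<in>UNIV - {k}. R k' l) * ?P"
      by (simp add: prod.remove[of UNIV l] flip: prod.distrib)
    finally have f: "f = (\<Prod>l'\<in>UNIV. R k l') * ((\<Prod>k'\<in>UNIV - {k}. R k' l) * ?P)" .
    have c: "c l = r k l * (\<Prod>k'\<in>UNIV - {k}. r k' l)"
      unfolding c_def by (rule prod.remove) auto
    have "f * p k * c l = ((\<Prod>l'\<in>UNIV. R k l') * p k)
        * ((\<Prod>k'\<in>UNIV - {k}. R k' l) * (\<Prod>k'\<in>UNIV - {k}. r k' l)) * (?P * r k l)"
      unfolding f c by (simp only: mult_ac)
    also have "(\<Prod>l'\<in>UNIV. R k l') * p k = 1"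
      by (simp add: p_def r flip: prod.distrib)
    also have "(\<Prod>k'\<in>UNIV - {k}. R k' l) * (\<Prod>k'\<in>UNIV - {k}. r k' l) = 1"
      by (simp add: r flip: prod.distrib)
    finally have fpc: "f * p k * c l = ?P * r k l"
      by simp
    have "\<alpha> k * \<beta> l * z = s_var k * t_var l * z * (f * p k * c l)"
      by (simp only: \<alpha>_def \<beta>_def mult_ac)
    also have "\<dots> = (s_var k * t_var l * x_var * y_var * ?P) * r k l"
      unfolding fpc z_def by (simp only: mult_ac)
    also have "s_var k * t_var l * x_var * y_var * ?P = R k l - 1"
      using R[of k l] by simp
    finally show ?thesis
      by (simp add: left_diff_distrib r)
  qed
  define A where "A = x_var * (\<Prod>l\<in>UNIV. 1 + \<beta> l * y_var)"
  define B where "B = y_var * f * (\<Prod>k\<in>UNIV. 1 + \<alpha> k * x_var)"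
  \<comment> \<open>The factor \<open>p k\<close> normalizes the cofactor to have leading term \<open>1\<close>: by the second equation of the
    divided difference, \<open>p k * (1 + s\<^sub>k z q0) = 1\<close>.\<close>
  have "\<exists>v. 1 + s_var k * A = (1 + \<alpha> k * x_var) * v \<and> p k * v - 1 \<in> deg_le (- 1)
      \<and> p k * v - 1 \<in> order_ideal 1" for k
  proof -
    obtain q0 q1 where q: "q0 \<in> deg_le 0" "q1 \<in> deg_le 0"
      and 1: "(\<Prod>l\<in>UNIV. 1 + \<beta> l * y_var) - (\<Prod>l\<in>UNIV. 1 + \<beta> l * (- \<alpha> k * z))
        = (y_var - (- \<alpha> k * z)) * (q0 + y_var * q1)"
      and 2: "1 - (\<Prod>l\<in>UNIV. 1 + \<beta> l * (- \<alpha> k * z)) = - (- \<alpha> k * z) * q0"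
    proof (rule product_divided_difference[of "{u. fst u - snd u \<le> 0}" y_var "- \<alpha> k * z" \<beta> UNIV])
      show "y_var \<in> supported {u. fst u - snd u \<le> 0}"
        using deg_le_mono[OF deg_y_var(1), of 0] by (simp add: deg_le_def)
      show "- \<alpha> k * z \<in> supported {u. fst u - snd u \<le> 0}"
        using supported_diagonal_deg(1)[OF supported_minus[OF supported_diagonal_mult[OF \<alpha>_diag z_diag]]]
        by (simp add: deg_le_def)
      show "\<beta> l \<in> supported {u. fst u - snd u \<le> 0}" for l
        using supported_diagonal_deg(1)[OF \<beta>_diag] by (simp add: deg_le_def)
    qed (auto simp: deg_le_def)
    have "1 + \<beta> l * (- \<alpha> k * z) = r k l" for l
      using \<alpha>\<beta>[of k l] by (simp add: mult_ac)
    then have pk: "(\<Prod>l\<in>UNIV. 1 + \<beta> l * (- \<alpha> k * z)) = p k"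
      by (simp only: p_def)
    let ?q = "q0 + y_var * q1"
    have b: "(\<Prod>l\<in>UNIV. 1 + \<beta> l * y_var) = p k + (y_var + \<alpha> k * z) * ?q"
      using 1 unfolding pk by (simp add: algebra_simps)
    have "1 + s_var k * A = 1 + \<alpha> k * x_var + s_var k * (x_var * y_var + \<alpha> k * x_var * z) * ?q"
      unfolding A_def b \<alpha>_def by (simp add: algebra_simps)
    also have "\<dots> = (1 + \<alpha> k * x_var) * (1 + s_var k * z * ?q)"
      unfolding z_def by (simp add: algebra_simps)
    finally have v: "1 + s_var k * A = (1 + \<alpha> k * x_var) * (1 + s_var k * z * ?q)" .
    have "p k * (1 + s_var k * z * ?q) - 1 = \<alpha> k * z * q0 - (1 - p k) + \<alpha> k * z * (y_var * q1)"
      unfolding \<alpha>_def by (simp add: algebra_simps)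
    also have "\<dots> = (\<alpha> k * z) * (y_var * q1)"
      using 2 unfolding pk by simp
    finally have pv: "p k * (1 + s_var k * z * ?q) - 1 = (\<alpha> k * z) * (y_var * q1)" .
    have "\<alpha> k * z \<in> deg_le 0"
      by (intro supported_diagonal_deg supported_diagonal_mult \<alpha>_diag z_diag)
    from deg_le_mult[OF this deg_le_mult[OF deg_y_var(1) q(2)]]
    have "(\<alpha> k * z) * (y_var * q1) \<in> deg_le (- 1)"
      by simp
    moreover have "(\<alpha> k * z) * (y_var * q1) \<in> order_ideal 1"
      unfolding \<alpha>_def by (intro order_ideal_mult_right s_var_in_order_ideal)
    ultimately show ?thesis
      using v pv by metis
  qed
  then have "\<exists>v v'. 1 + s_var k * A = (1 + \<alpha> k * x_var) * v \<and> p k * v * v' = 1 \<and> v' - 1 \<in> deg_le (- 1)" for k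
    using deg_le_unit_inverse by meson
  then obtain v v' where v: "\<And>k. 1 + s_var k * A = (1 + \<alpha> k * x_var) * v k"
    and vv': "\<And>k. p k * v k * v' k = 1" and v': "\<And>k. v' k - 1 \<in> deg_le (- 1)"
    by metis
  have "\<exists>w. 1 + t_var l * B = (1 + \<beta> l * y_var) * w \<and> w - 1 \<in> deg_ge 0 \<and> w - 1 \<in> order_ideal 1" for l
  proof -
    obtain q0 q1 where q: "q0 \<in> deg_ge 0" "q1 \<in> deg_ge 0"
      and 1: "(\<Prod>k\<in>UNIV. 1 + \<alpha> k * x_var) - (\<Prod>k\<in>UNIV. 1 + \<alpha> k * (- \<beta> l * z))
        = (x_var - (- \<beta> l * z)) * (q0 + x_var * q1)"
    proof (rule product_divided_difference[of "{u. 0 \<le> fst u - snd u}" x_var "- \<beta> l * z" \<alpha> UNIV])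
      show "x_var \<in> supported {u. 0 \<le> fst u - snd u}"
        using deg_ge_mono[OF deg_x_var(2), of 0] by (simp add: deg_ge_def)
      show "- \<beta> l * z \<in> supported {u. 0 \<le> fst u - snd u}"
        using supported_diagonal_deg(2)[OF supported_minus[OF supported_diagonal_mult[OF \<beta>_diag z_diag]]]
        by (simp add: deg_ge_def)
      show "\<alpha> k \<in> supported {u. 0 \<le> fst u - snd u}" for k
        using supported_diagonal_deg(2)[OF \<alpha>_diag] by (simp add: deg_ge_def)
    qed (auto simp: deg_ge_def)
    have "1 + \<alpha> k * (- \<beta> l * z) = r k l" for k
      using \<alpha>\<beta>[of k l] by (simp add: mult_ac)
    then have cl: "(\<Prod>k\<in>UNIV. 1 + \<alpha> k * (- \<beta> l * z)) = c l"
      by (simp only: c_def)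
    let ?q = "q0 + x_var * q1"
    have a: "(\<Prod>k\<in>UNIV. 1 + \<alpha> k * x_var) = c l + (x_var + \<beta> l * z) * ?q"
      using 1 unfolding cl by (simp add: algebra_simps)
    have "1 + t_var l * B = 1 + \<beta> l * y_var + t_var l * f * (x_var * y_var + \<beta> l * y_var * z) * ?q"
      unfolding B_def a \<beta>_def by (simp add: algebra_simps)
    also have "\<dots> = (1 + \<beta> l * y_var) * (1 + t_var l * f * z * ?q)"
      unfolding z_def by (simp add: algebra_simps)
    finally have w: "1 + t_var l * B = (1 + \<beta> l * y_var) * (1 + t_var l * f * z * ?q)" .
    have "t_var l * f * z \<in> deg_ge 0"
      by (intro supported_diagonal_deg supported_diagonal_mult vars f_diag z_diag)
    moreover have "?q \<in> deg_ge 0"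
      using deg_ge_add[OF q(1) deg_ge_mono[OF deg_ge_mult[OF deg_x_var(2) q(2)], of 0]] by simp
    ultimately have "t_var l * f * z * ?q \<in> deg_ge 0"
      using deg_ge_mult[of "t_var l * f * z" 0 ?q 0] by simp
    moreover have "t_var l * f * z * ?q \<in> order_ideal 1"
      by (intro order_ideal_mult_right t_var_in_order_ideal)
    ultimately show ?thesis
      using w by (intro exI[of _ "1 + t_var l * f * z * ?q"]) simp
  qed
  then have "\<exists>w w'. 1 + t_var l * B = (1 + \<beta> l * y_var) * w \<and> w * w' = 1 \<and> w' - 1 \<in> deg_ge 0" for l
    using deg_ge_unit_inverse by meson
  then obtain w w' where w: "\<And>l. 1 + t_var l * B = (1 + \<beta> l * y_var) * w l"
    and ww': "\<And>l. w l * w' l = 1" and w': "\<And>l. w' l - 1 \<in> deg_ge 0"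
    by metis
  define X where "X = x_var * (\<Prod>l\<in>UNIV. w' l)"
  define Y where "Y = y_var * (\<Prod>k\<in>UNIV. v' k)"
  have "A - x_var \<in> deg_le 0"
  proof -
    have "(\<Prod>l\<in>UNIV. 1 + \<beta> l * y_var) - 1 \<in> deg_le (- 1)"
      unfolding deg_le_def
    proof (rule one_plus_supported_prod)
      show "1 + \<beta> l * y_var - 1 \<in> supported {u. fst u - snd u \<le> - 1}" for l
        using deg_le_mult[OF supported_diagonal_deg(1)[OF \<beta>_diag] deg_y_var(1)] by (simp add: deg_le_def)
    qed auto
    from deg_le_mult[OF deg_x_var(1) this] show ?thesis
      by (simp add: A_def right_diff_distrib)
  qed
  moreover have "X \<in> deg_ge 1"
  proof -
    have "(\<Prod>l\<in>UNIV. w' l) - 1 \<in> deg_ge 0"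
      using w' unfolding deg_ge_def by (intro one_plus_supported_prod) auto
    from deg_ge_mult[OF deg_x_var(2) this] have "x_var * ((\<Prod>l\<in>UNIV. w' l) - 1) \<in> deg_ge 1"
      by simp
    from deg_ge_add[OF this deg_x_var(2)] show ?thesis
      by (simp add: X_def right_diff_distrib)
  qed
  moreover have "A - X * (\<Prod>l\<in>UNIV. 1 + t_var l * B) \<in> order_ideal N"
  proof -
    have "X * (\<Prod>l\<in>UNIV. 1 + t_var l * B) =
        x_var * ((\<Prod>l\<in>UNIV. 1 + \<beta> l * y_var) * (\<Prod>l\<in>UNIV. w l * w' l))"
      unfolding X_def w prod.distrib by (simp only: mult_ac)
    then show ?thesis
      by (simp add: ww' A_def)
  qed
  moreover have "B - y_var * f \<in> deg_ge 0"
  proof -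
    have "(\<Prod>k\<in>UNIV. 1 + \<alpha> k * x_var) - 1 \<in> deg_ge 1"
      unfolding deg_ge_def
    proof (rule one_plus_supported_prod)
      show "1 + \<alpha> k * x_var - 1 \<in> supported {u. 1 \<le> fst u - snd u}" for k
        using deg_ge_mult[OF supported_diagonal_deg(2)[OF \<alpha>_diag] deg_x_var(2)] by (simp add: deg_ge_def)
    qed auto
    from deg_ge_mult[OF deg_ge_mult[OF deg_y_var(2) supported_diagonal_deg(2)[OF f_diag]] this] show ?thesis
      by (simp add: B_def right_diff_distrib)
  qed
  moreover have "Y - y_var \<in> deg_le (- 2)"
  proof -
    have "(\<Prod>k\<in>UNIV. v' k) - 1 \<in> deg_le (- 1)"
      using v' unfolding deg_le_def by (intro one_plus_supported_prod) auto
    from deg_le_mult[OF deg_y_var(1) this] show ?thesis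
      by (simp add: Y_def right_diff_distrib)
  qed
  moreover have "B - Y * (\<Prod>k\<in>UNIV. 1 + s_var k * A) \<in> order_ideal N"
  proof -
    have "Y * (\<Prod>k\<in>UNIV. 1 + s_var k * A) =
        y_var * (f * (\<Prod>k\<in>UNIV. p k)) * ((\<Prod>k\<in>UNIV. 1 + \<alpha> k * x_var) * (\<Prod>k\<in>UNIV. v k)) * (\<Prod>k\<in>UNIV. v' k)"
      unfolding fp Y_def v prod.distrib by (simp add: mult_ac)
    also have "\<dots> = y_var * f * (\<Prod>k\<in>UNIV. 1 + \<alpha> k * x_var) * (\<Prod>k\<in>UNIV. p k * v k * v' k)"
      unfolding prod.distrib by (simp only: mult_ac)
    finally show ?thesis
      by (simp add: vv' B_def)
  qed
  ultimately have "birkhoff_mod N f A B X Y"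
    unfolding birkhoff_mod_def by blast
  then show thesis
    using that unfolding f_def by blast
qed

theorem theorem11p1:
  fixes f :: "nat \<times> nat \<Rightarrow> ('k::finite, 'l::finite) B_ring"
  assumes "ordered_factorization
     (tv_aut 1 0 (\<Prod>k\<in>UNIV. 1 + s_var k * x_var) \<circ> tv_aut 0 1 (\<Prod>l\<in>UNIV. 1 + t_var l * y_var)) f"
  shows "\<exists>R :: 'k \<Rightarrow> 'l \<Rightarrow> ('k, 'l) B_ring.
     (\<forall>R'. (\<forall>k l. R' k l = 1 + s_var k * t_var l * x_var * y_var *
               (\<Prod>k'\<in>UNIV - {k}. \<Prod>l'\<in>UNIV - {l}. R' k' l')) \<longleftrightarrow> R' = R) \<and>
     f (1, 1) = (\<Prod>k\<in>UNIV. \<Prod>l\<in>UNIV. R k l)"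
proof -
  obtain R :: "'k \<Rightarrow> 'l \<Rightarrow> ('k, 'l) B_ring" where
    R: "\<And>R'. (\<forall>k l. R' k l = 1 + s_var k * t_var l * x_var * y_var *
               (\<Prod>k'\<in>UNIV - {k}. \<Prod>l'\<in>UNIV - {l}. R' k' l')) \<longleftrightarrow> R' = R"
    and diag: "\<And>k l. R k l \<in> supported diagonal"
    using functional_equations_unique_solution by blast
  have eq: "R k l = 1 + s_var k * t_var l * x_var * y_var *
               (\<Prod>k'\<in>UNIV - {k}. \<Prod>l'\<in>UNIV - {l}. R k' l')" for k l
    using R[of R] by blast
  let ?f = "\<Prod>k\<in>UNIV. \<Prod>l\<in>UNIV. R k l"
  have "f (1, 1) \<in> tv_series 1 1"
    using assms unfolding ordered_factorization_def
    by (metis coprime_1_left of_nat_1)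
  then have "f (1, 1) - 1 \<in> supported (ray 1 1)"
    by (simp add: tv_series_iff)
  then have "f (1, 1) - 1 \<in> supported diagonal"
    by (rule supported_mono) (auto simp: ray_def diagonal_def)
  from supported_add[OF this supported_one[OF diagonal_add(1)]]
  have f_diag: "f (1, 1) \<in> supported diagonal"
    by simp
  have R_diag: "?f \<in> supported diagonal"
    by (intro supported_prod diagonal_add diag)
  have "f (1, 1) - ?f \<in> order_ideal N" for N
  proof -
    obtain A B X Y where "birkhoff_mod N (f (1, 1)) A B X Y"
      by (rule ordered_factorization_imp_birkhoff_mod[OF assms])
    moreover obtain A' B' X' Y' where "birkhoff_mod N ?f A' B' X' Y'"
      by (rule functional_equations_birkhoff_mod[OF eq diag])
    ultimately show ?thesis
      by (rule birkhoff_mod_unique) (intro supported_diagonal_deg f_diag R_diag)+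
  qed
  then have "f (1, 1) = ?f"
    using order_ideal_Inter[of "f (1, 1) - ?f"] by simp
  then show ?thesis
    using R by blast
qed

end
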